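(* Let $p\in[1,\infty]$, let $d\ge 1$ be an integer, and let $E=\{E_a\}_{a=1}^{n_E}$ and $F=\{F_b\}_{b=1}^{n_F}$ be two measurements acting on $\mathbb{C}^d$. Then $$\Upsilon_p(E,F)\le 2^{\frac1p}\, d\sqrt{d-1}.$$ This upper bound is tight: it is saturated (holds with equality) when $E_a=|e_a\rangle\langle e_a|$ and $F_b=|f_b\rangle\langle f_b|$ for a pair of mutually unbiased bases $\{|e_a\rangle\}_{a=1}^d$, $\{|f_b\rangle\}_{b=1}^d$ of $\mathbb{C}^d$.
   Context: A measurement with $n$ outcomes acting on $\mathbb{C}^d$ is a family $\{E_a\}_{a=1}^n$ of non-zero positive semi-definite operators on $\mathbb{C}^d$ with $\sum_a E_a=\mathbb{1}$. The Schatten $p$-norm $\|A\|_p$ is the $\ell_p$-norm of the vector of singular values of $A$ (the largest singular value for $p=\infty$). Define $\Upsilon_p(E,F):=\sum_{a=1}^{n_E}\sum_{b=1}^{n_F}\|[E_a,F_b]\|_p$, where $[A,B]=AB-BA$. Convention: $2^{1/p}=1$ for $p=\infty$. Two orthonormal bases $\{|e_j\rangle\}$, $\{|f_k\rangle\}$ of $\mathbb{C}^d$ are mutually unbiased if $|\langle e_j|f_k\rangle|^2=\frac1d$ for all $j,k\in\{1,\dots,d\}$. *)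

theory Defs
  imports
    "Jordan_Normal_Form.Char_Poly"
    "Jordan_Normal_Form.Schur_Decomposition"
    "HOL-Library.Extended_Real"
begin

definition positive_semidefinite :: "nat \<Rightarrow> complex mat \<Rightarrow> bool" where
  "positive_semidefinite d A \<longleftrightarrow>
     A \<in> carrier_mat d d \<and> mat_adjoint A = A \<and>
     (\<forall>v \<in> carrier_vec d. 0 \<le> Re ((A *\<^sub>v v) \<bullet>c v))"

(* The outcomes are labelled 1, ..., n; values of E outside this range are irrelevant.
   The sum of the operators is written out entrywise. *)
definition is_measurement :: "nat \<Rightarrow> nat \<Rightarrow> (nat \<Rightarrow> complex mat) \<Rightarrow> bool" where
  "is_measurement d n E \<longleftrightarrow>
     (\<forall>a \<in> {1..n}. positive_semidefinite d (E a) \<and> E a \<noteq> 0\<^sub>m d d) \<and>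
     mat d d (\<lambda>(i, j). \<Sum>a = 1..n. E a $$ (i, j)) = 1\<^sub>m d"

(* Square roots of the eigenvalues of A\<^sup>*A, counted with multiplicity. These eigenvalues are
   real and non-negative, so taking the real part discards nothing. *)
definition singular_values :: "complex mat \<Rightarrow> real multiset" where
  "singular_values A =
     image_mset (\<lambda>x. sqrt (Re x)) (proots (char_poly (mat_adjoint A * A)))"

definition schatten_norm :: "ereal \<Rightarrow> complex mat \<Rightarrow> real" where
  "schatten_norm p A =
     (if p = \<infinity> then Max (set_mset (singular_values A))
      else (\<Sum>s \<in># singular_values A. s powr real_of_ereal p) powr (1 / real_of_ereal p))"

definition commutator :: "complex mat \<Rightarrow> complex mat \<Rightarrow> complex mat" where
  "commutator A B = A * B - B * A"

definition Upsilon ::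
  "ereal \<Rightarrow> nat \<Rightarrow> nat \<Rightarrow> (nat \<Rightarrow> complex mat) \<Rightarrow> (nat \<Rightarrow> complex mat) \<Rightarrow> real" where
  "Upsilon p nE nF E F =
     (\<Sum>a = 1..nE. \<Sum>b = 1..nF. schatten_norm p (commutator (E a) (F b)))"

definition two_powr_inverse :: "ereal \<Rightarrow> real" where
  "two_powr_inverse p = (if p = \<infinity> then 1 else 2 powr (1 / real_of_ereal p))"

(* v \<bullet>c w is linear in v and conjugate-linear in w, so the inner product <v|w> of the bra-ket
   notation is w \<bullet>c v. Any d orthonormal vectors in dimension d form a basis. *)
definition orthonormal_basis :: "nat \<Rightarrow> (nat \<Rightarrow> complex vec) \<Rightarrow> bool" where
  "orthonormal_basis d e \<longleftrightarrow>
     (\<forall>j \<in> {1..d}. e j \<in> carrier_vec d) \<and>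
     (\<forall>j \<in> {1..d}. \<forall>k \<in> {1..d}. e k \<bullet>c e j = (if j = k then 1 else 0))"

definition mutually_unbiased_bases ::
  "nat \<Rightarrow> (nat \<Rightarrow> complex vec) \<Rightarrow> (nat \<Rightarrow> complex vec) \<Rightarrow> bool" where
  "mutually_unbiased_bases d e f \<longleftrightarrow>
     orthonormal_basis d e \<and> orthonormal_basis d f \<and>
     (\<forall>j \<in> {1..d}. \<forall>k \<in> {1..d}. (cmod (f k \<bullet>c e j))\<^sup>2 = 1 / real d)"

(* The operator |v><v|. *)
definition ket_bra :: "complex vec \<Rightarrow> complex mat" where
  "ket_bra v = mat (dim_vec v) (dim_vec v) (\<lambda>(i, j). v $ i * cnj (v $ j))"

end

theory Submission
  imports Defs "HOL-Analysis.L2_Norm"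
begin

text \<open>
  The commutator \<open>K = [E, F]\<close> of two positive operators is anti-Hermitian and traceless, so its
  singular values are \<open>\<bar>\<lambda>\<^sub>m\<bar>\<close> with real \<open>\<lambda>\<^sub>m\<close> summing to zero. The positive and the negative
  \<open>\<lambda>\<^sub>m\<close> therefore carry equal weight, whence \<open>\<parallel>K\<parallel>\<^sub>p \<le> 2 powr (1 / p) * \<parallel>K\<parallel>\<^sub>1 / 2\<close>, and only
  \<open>p = 1\<close> remains. Writing \<open>E\<close> and \<open>F\<close> as sums of operators \<open>|x\<^sub>j\<rangle>\<langle>x\<^sub>j|\<close> and \<open>|y\<^sub>k\<rangle>\<langle>y\<^sub>k|\<close>
  and pairing \<open>K\<close> with its sign, each term contributes at most
  \<open>2 * c * sqrt (\<parallel>x\<^sub>j\<parallel>\<^sup>2 * \<parallel>y\<^sub>k\<parallel>\<^sup>2 - c\<^sup>2)\<close> with \<open>c = \<bar>\<langle>x\<^sub>j|y\<^sub>k\<rangle>\<bar>\<close>. Two applications of Cauchy-Schwarz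
  give first \<open>\<parallel>K\<parallel>\<^sub>1 / 2 \<le> sqrt (tr (E F)) * sqrt (tr E * tr F - tr (E F))\<close>, and then the bound, since
  over all outcomes \<open>tr (E F)\<close> sums to \<open>d\<close> and \<open>tr E * tr F\<close> to \<open>d\<^sup>2\<close>.

  For rank-one projections \<open>P, Q\<close> with \<open>tr (P Q) = t\<close> the commutator satisfies
  \<open>K\<^sup>3 = - t * (1 - t) * K\<close> and \<open>tr (K\<^sup>2) = - 2 * t * (1 - t)\<close>, so exactly two singular values equal
  \<open>sqrt (t * (1 - t))\<close> and the others vanish. The standard and the Fourier basis are mutually
  unbiased in every dimension.
\<close>

section \<open>Unitary diagonalization of Hermitian matrices\<close>

lemma index_mult_mat_sum:
  assumes "A \<in> carrier_mat n m" "B \<in> carrier_mat m l" "i < n" "j < l"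
  shows "(A * B) $$ (i, j) = (\<Sum>k<m. A $$ (i, k) * B $$ (k, j))"
  using assms by (auto simp: scalar_prod_def atLeast0LessThan)

lemma mat_adjoint_carrier [simp]:
  "A \<in> carrier_mat n m \<Longrightarrow> mat_adjoint A \<in> carrier_mat m n"
  unfolding mat_adjoint_def by (auto simp: mat_of_rows_def)

lemma mat_adjoint_index [simp]:
  "i < dim_col A \<Longrightarrow> j < dim_row A \<Longrightarrow> mat_adjoint A $$ (i, j) = conjugate (A $$ (j, i))"
  unfolding mat_adjoint_def by (auto simp: mat_of_rows_def)

lemma mat_adjoint_dim [simp]:
  "dim_row (mat_adjoint A) = dim_col A" "dim_col (mat_adjoint A) = dim_row A"
  unfolding mat_adjoint_def by auto

lemma mat_adjoint_adjoint [simp]: "mat_adjoint (mat_adjoint A) = A"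
  by (rule eq_matI) auto

lemma mat_adjoint_mult:
  fixes A :: "complex mat"
  assumes "A \<in> carrier_mat n m" "B \<in> carrier_mat m l"
  shows "mat_adjoint (A * B) = mat_adjoint B * mat_adjoint A"
proof (rule eq_matI)
  fix i j assume "i < dim_row (mat_adjoint B * mat_adjoint A)" "j < dim_col (mat_adjoint B * mat_adjoint A)"
  hence i: "i < l" and j: "j < n" using assms by auto
  have "mat_adjoint (A * B) $$ (i, j) = cnj ((A * B) $$ (j, i))"
    using assms i j by (subst mat_adjoint_index) auto
  also have "\<dots> = (\<Sum>k<m. mat_adjoint B $$ (i, k) * mat_adjoint A $$ (k, j))"
    using assms i j by (subst index_mult_mat_sum[OF assms]) (auto intro!: sum.cong)
  also have "\<dots> = (mat_adjoint B * mat_adjoint A) $$ (i, j)"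
    using assms i j by (subst index_mult_mat_sum[of _ l m _ n]) auto
  finally show "mat_adjoint (A * B) $$ (i, j) = (mat_adjoint B * mat_adjoint A) $$ (i, j)" .
qed (use assms in auto)

text \<open>A one-sided inverse is enough of a definition: for square matrices it is two-sided, as
  \<open>unitary_matD\<close> records.\<close>

definition unitary_mat :: "nat \<Rightarrow> complex mat \<Rightarrow> bool" where
  "unitary_mat n U \<longleftrightarrow> U \<in> carrier_mat n n \<and> mat_adjoint U * U = 1\<^sub>m n"

lemma unitary_matD:
  assumes "unitary_mat n U"
  shows "U \<in> carrier_mat n n" "mat_adjoint U \<in> carrier_mat n n"
    "mat_adjoint U * U = 1\<^sub>m n" "U * mat_adjoint U = 1\<^sub>m n"
  using assms mat_mult_left_right_inverse[of "mat_adjoint U" n U]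
  unfolding unitary_mat_def by auto

lemma unitary_mat_mult:
  assumes "unitary_mat n U" "unitary_mat n V"
  shows "unitary_mat n (U * V)"
proof -
  note U = unitary_matD[OF assms(1)] and V = unitary_matD[OF assms(2)]
  have "mat_adjoint (U * V) * (U * V) = mat_adjoint V * mat_adjoint U * (U * V)"
    using U V by (subst mat_adjoint_mult[of _ n n _ n]) auto
  also have "\<dots> = mat_adjoint V * (mat_adjoint U * U) * V"
    using U(1,2) V(1,2) by (simp add: assoc_mult_mat[of _ n n _ n _ n] mult_carrier_mat[of _ n n _ n])
  also have "\<dots> = 1\<^sub>m n" unfolding U(3) using V by simp
  finally show ?thesis unfolding unitary_mat_def using U V by auto
qed

text \<open>Completing \<open>v\<close> to a basis and orthogonalizing keeps \<open>v\<close> as the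
  first vector; normalization then rescales it, whence the factor \<open>c\<close>. This supplies
  the change of basis for the deflation in \<open>hermitian_diagonalization\<close>.\<close>

lemma unitary_first_column:
  fixes v :: "complex vec"
  assumes v: "v \<in> carrier_vec n" and v0: "v \<noteq> 0\<^sub>v n"
  obtains W c where "unitary_mat n W" "col W 0 = c \<cdot>\<^sub>v v"
proof -
  interpret cof_vec_space n "TYPE(complex)" .
  have n: "n \<noteq> 0"
  proof
    assume "n = 0"
    with v v0 show False by (metis carrier_vecD eq_vecI index_zero_vec(2) not_less0)
  qed
  define b where "b = basis_completion v"
  define ws where "ws = gram_schmidt n b"
  from basis_completion[OF v v0, folded b_def]
  have dist_b: "distinct b" and indep: "\<not> lin_dep (set b)" and b: "set b \<subseteq> carrier_vec n"
    and hdb: "hd b = v" and len_b: "length b = n" by auto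
  from hdb len_b n obtain vs where bv: "b = v # vs" by (cases b, auto)
  from gram_schmidt_result[OF b dist_b indep refl, folded ws_def]
  have ws: "set ws \<subseteq> carrier_vec n" "corthogonal ws" "length ws = n" by (auto simp: len_b)
  from gram_schmidt_hd[OF v, of vs, folded bv] have hdws: "hd ws = v" unfolding ws_def .
  have wsc: "ws ! i \<in> carrier_vec n" if "i < n" for i using that ws by auto
  \<comment> \<open>\<open>gram_schmidt\<close> delivers orthogonal vectors of arbitrary non-zero
    length; \<open>r\<close> holds their norms, by which the columns of \<open>W\<close> are
    divided.\<close>
  define r where "r i = sqrt (Re (ws ! i \<bullet>c ws ! i))" for i
  have sq: "ws ! i \<bullet>c ws ! i = complex_of_real (r i) * complex_of_real (r i) \<and> r i \<noteq> 0" if "i < n" for i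
  proof -
    have ge: "ws ! i \<bullet>c ws ! i \<ge> 0" by (rule conjugate_square_ge_0_vec)
    have ne: "ws ! i \<bullet>c ws ! i \<noteq> 0" using corthogonalD[OF ws(2), of i i] that ws(3) by auto
    from ge have re: "Re (ws ! i \<bullet>c ws ! i) \<ge> 0" and im: "Im (ws ! i \<bullet>c ws ! i) = 0"
      by (auto simp: less_eq_complex_def)
    have "Re (ws ! i \<bullet>c ws ! i) \<noteq> 0" using ne im by (auto simp: complex_eq_iff)
    thus ?thesis using re im unfolding r_def of_real_mult[symmetric]
      by (auto simp: complex_eq_iff)
  qed
  define W where "W = mat n n (\<lambda>(i, j). ws ! j $ i / complex_of_real (r j))"
  have W: "W \<in> carrier_mat n n" unfolding W_def by auto
  have "mat_adjoint W * W = 1\<^sub>m n"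
  proof (rule eq_matI)
    fix i j assume "i < dim_row (1\<^sub>m n :: complex mat)" "j < dim_col (1\<^sub>m n :: complex mat)"
    hence i: "i < n" and j: "j < n" by auto
    have "(mat_adjoint W * W) $$ (i, j) = (\<Sum>k<n. mat_adjoint W $$ (i, k) * W $$ (k, j))"
      using W i j by (subst index_mult_mat_sum[of _ n n _ n]) auto
    also have "\<dots> = (\<Sum>k<n. ws ! j $ k * cnj (ws ! i $ k)) / (complex_of_real (r i) * complex_of_real (r j))"
      unfolding sum_divide_distrib using i j by (intro sum.cong) (auto simp: W_def)
    also have "(\<Sum>k<n. ws ! j $ k * cnj (ws ! i $ k)) = ws ! j \<bullet>c ws ! i"
      using wsc[OF i] wsc[OF j] by (auto simp: scalar_prod_def atLeast0LessThan intro!: sum.cong)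
    also have "ws ! j \<bullet>c ws ! i / (complex_of_real (r i) * complex_of_real (r j)) = (if i = j then 1 else 0)"
      using sq[OF i] corthogonalD[OF ws(2), of j i] i j ws(3) by auto
    finally show "(mat_adjoint W * W) $$ (i, j) = 1\<^sub>m n $$ (i, j)" using i j by auto
  qed (use W in auto)
  hence "unitary_mat n W" using W unfolding unitary_mat_def by auto
  moreover have "ws ! 0 = v" using n hdws ws(3) by (cases ws) auto
  hence "col W 0 = (1 / complex_of_real (r 0)) \<cdot>\<^sub>v v"
    using n v by (intro eq_vecI) (auto simp: W_def)
  ultimately show ?thesis using that by blast
qed

lemma unitary_conj_hermitian:
  fixes A :: "complex mat"
  assumes "U \<in> carrier_mat n m" "A \<in> carrier_mat n n" "mat_adjoint A = A"
  shows "mat_adjoint (mat_adjoint U * A * U) = mat_adjoint U * A * U"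
proof -
  have "mat_adjoint (mat_adjoint U * A * U) = mat_adjoint U * mat_adjoint (mat_adjoint U * A)"
    using assms by (subst mat_adjoint_mult[of _ m n _ m]) auto
  also have "mat_adjoint (mat_adjoint U * A) = A * U"
    using assms by (subst mat_adjoint_mult[of _ m n _ n]) auto
  also have "mat_adjoint U * (A * U) = mat_adjoint U * A * U"
    using assms by (subst assoc_mult_mat[of _ m n _ n _ m]) auto
  finally show ?thesis .
qed

text \<open>Deflation: in an orthonormal basis that starts with an eigenvector, the first column
  vanishes off the diagonal, Hermitian symmetry clears the first row as well, and the induction
  hypothesis diagonalizes the remaining block.\<close>

lemma hermitian_diagonalization:
  fixes A :: "complex mat"
  assumes "A \<in> carrier_mat n n" "mat_adjoint A = A"
  obtains U where "unitary_mat n U" "diagonal_mat (mat_adjoint U * A * U)"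
proof -
  have "\<exists>U. unitary_mat n U \<and> diagonal_mat (mat_adjoint U * A * U)"
    using assms
  proof (induction n arbitrary: A)
    case 0
    show ?case by (rule exI[of _ "1\<^sub>m 0"]) (use 0 in \<open>auto simp: unitary_mat_def diagonal_mat_def\<close>)
  next
    case (Suc n)
    note A = Suc.prems
    let ?n = "Suc n"
    obtain as where "char_poly A = (\<Prod>a\<leftarrow>as. [:- a, 1:])" "length as = ?n"
      using char_poly_factorized[OF A(1)] by auto
    then obtain e where "poly (char_poly A) e = 0"
      by (cases as) auto
    hence "eigenvalue A e" using eigenvalue_root_char_poly[OF A(1)] by simp
    then obtain v where v: "v \<in> carrier_vec ?n" "v \<noteq> 0\<^sub>v ?n" "A *\<^sub>v v = e \<cdot>\<^sub>v v"
      unfolding eigenvalue_def eigenvector_def using A by auto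
    obtain W c where W: "unitary_mat ?n W" "col W 0 = c \<cdot>\<^sub>v v"
      using unitary_first_column[OF v(1,2)] by blast
    note WD = unitary_matD[OF W(1)]
    define B where "B = mat_adjoint W * A * W"
    have B: "B \<in> carrier_mat ?n ?n" unfolding B_def using WD A by auto
    have Bh: "mat_adjoint B = B" unfolding B_def using unitary_conj_hermitian WD(1) A by blast
    \<comment> \<open>The first column of \<open>A * W\<close> is \<open>e\<close> times that of
      \<open>W\<close>, so the entry is \<open>e\<close> times an off-diagonal entry of the
      identity.\<close>
    have col0: "B $$ (i, 0) = 0" if "i < ?n" "i \<noteq> 0" for i
    proof -
      have "A *\<^sub>v col W 0 = e \<cdot>\<^sub>v col W 0" unfolding W(2)
        using v A by (simp add: mult_mat_vec[OF A(1)] smult_smult_assoc mult.commute)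
      hence "col (A * W) 0 = e \<cdot>\<^sub>v col W 0"
        using A WD by (subst col_mult2[of _ ?n ?n _ ?n]) auto
      hence "B $$ (i, 0) = row (mat_adjoint W) i \<bullet> (e \<cdot>\<^sub>v col W 0)"
        unfolding B_def using WD A that by (simp add: assoc_mult_mat[of _ ?n ?n _ ?n _ ?n])
      also have "\<dots> = e * (mat_adjoint W * W) $$ (i, 0)"
        using WD(1,2) that by simp
      also have "\<dots> = 0" unfolding WD(3) using that by simp
      finally show ?thesis .
    qed
    have row0: "B $$ (0, i) = 0" if "i < ?n" "i \<noteq> 0" for i
      using col0[OF that] B that arg_cong[OF Bh, of "\<lambda>M. M $$ (0, i)"] by auto
    define C where "C = mat n n (\<lambda>(i, j). B $$ (Suc i, Suc j))"
    have C: "C \<in> carrier_mat n n" unfolding C_def by auto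
    have Ch: "mat_adjoint C = C"
    proof (rule eq_matI)
      fix i j assume "i < dim_row C" "j < dim_col C"
      thus "mat_adjoint C $$ (i, j) = C $$ (i, j)"
        using B arg_cong[OF Bh, of "\<lambda>M. M $$ (Suc i, Suc j)"] by (auto simp: C_def)
    qed (use C in auto)
    from Suc.IH[OF C Ch] obtain V where V: "unitary_mat n V" "diagonal_mat (mat_adjoint V * C * V)"
      by auto
    note VD = unitary_matD[OF V(1)]
    \<comment> \<open>\<open>?f a M\<close> is the block-diagonal sum of a scalar and a matrix. It
      is multiplicative, so a unitary \<open>V\<close> on the smaller block extends to a unitary
      \<open>V'\<close> that fixes the first basis vector.\<close>
    let ?f = "\<lambda>a M. four_block_mat (mat 1 1 (\<lambda>_. a)) (0\<^sub>m 1 n) (0\<^sub>m n 1) M :: complex mat"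
    have fm: "?f a M * ?f b N = ?f (a * b) (M * N)"
      if "M \<in> carrier_mat n n" "N \<in> carrier_mat n n" for a b M N
      using that
      by (subst mult_four_block_mat[of _ 1 1 _ n _ n _ _ 1 _ n])
         (auto intro!: cong_four_block_mat eq_matI simp: scalar_prod_def)
    have fa: "mat_adjoint (?f 1 M) = ?f 1 (mat_adjoint M)" if "M \<in> carrier_mat n n" for M
      using that by (intro eq_matI) auto
    have BC: "B = ?f (B $$ (0,0)) C"
      using B col0 row0 by (intro eq_matI) (auto simp: C_def)
    have f1: "?f 1 (1\<^sub>m n) = 1\<^sub>m ?n" by (intro eq_matI) auto
    define V' where "V' = ?f 1 V"
    have V'c: "V' \<in> carrier_mat ?n ?n" unfolding V'_def using VD by auto
    have V'a: "mat_adjoint V' = ?f 1 (mat_adjoint V)" unfolding V'_def using fa VD by auto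
    have V': "unitary_mat ?n V'"
      unfolding unitary_mat_def V'a using V'c fm[OF VD(2,1), of 1 1] VD(3) f1 by (simp add: V'_def)
    have "mat_adjoint V' * B * V' = ?f (B $$ (0,0)) (mat_adjoint V * C * V)"
      unfolding V'a
      using fm[OF VD(2) C, of 1 "B $$ (0,0)"] fm[of "mat_adjoint V * C" V "B $$ (0,0)" 1] VD C
      by (subst BC) (simp add: V'_def del: assoc_mult_mat)
    hence diag: "diagonal_mat (mat_adjoint V' * B * V')"
      using V(2) VD C unfolding diagonal_mat_def by auto
    have "mat_adjoint (W * V') * A * (W * V') = mat_adjoint V' * B * V'"
      unfolding B_def using WD V'c A
      by (simp add: mat_adjoint_mult[of _ ?n ?n _ ?n] assoc_mult_mat[of _ ?n ?n _ ?n _ ?n]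
          mult_carrier_mat[of _ ?n ?n _ ?n])
    with diag unitary_mat_mult[OF W(1) V'] show ?case by metis
  qed
  thus ?thesis using that by blast
qed

section \<open>Inequalities for finite families\<close>

text \<open>Cauchy-Schwarz in a form that serves at three levels: coordinates of two vectors, pairs
  of rank-one terms, and pairs of outcomes.\<close>

lemma sum_mult_le_sqrt:
  fixes f g :: "'a \<Rightarrow> real"
  assumes "\<And>i. i \<in> I \<Longrightarrow> 0 \<le> f i" "\<And>i. i \<in> I \<Longrightarrow> 0 \<le> g i"
  shows "(\<Sum>i\<in>I. sqrt (f i) * sqrt (g i)) \<le> sqrt (\<Sum>i\<in>I. f i) * sqrt (\<Sum>i\<in>I. g i)"
proof -
  have "(\<Sum>i\<in>I. sqrt (f i) * sqrt (g i)) = (\<Sum>i\<in>I. \<bar>sqrt (f i)\<bar> * \<bar>sqrt (g i)\<bar>)"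
    using assms by (intro sum.cong) auto
  also have "\<dots> \<le> L2_set (\<lambda>i. sqrt (f i)) I * L2_set (\<lambda>i. sqrt (g i)) I"
    by (rule L2_set_mult_ineq)
  also have "\<dots> = sqrt (\<Sum>i\<in>I. f i) * sqrt (\<Sum>i\<in>I. g i)"
    unfolding L2_set_def using assms by (intro arg_cong2[of _ _ _ _ "(*)"] arg_cong[of _ _ sqrt] sum.cong) auto
  finally show ?thesis .
qed

text \<open>An entry is minus the sum of the others, so its modulus is at most the total of theirs,
  hence at most half of the whole.\<close>

lemma abs_le_of_sum_zero:
  fixes l :: "'a \<Rightarrow> real"
  assumes "finite I" "(\<Sum>i\<in>I. l i) = 0" "(\<Sum>i\<in>I. \<bar>l i\<bar>) \<le> 2 * P" "j \<in> I"
  shows "\<bar>l j\<bar> \<le> P"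
proof -
  have "l j = - (\<Sum>i\<in>I-{j}. l i)" using assms by (simp add: sum.remove[of I j])
  hence "\<bar>l j\<bar> \<le> (\<Sum>i\<in>I-{j}. \<bar>l i\<bar>)" using sum_abs[of l "I-{j}"] by simp
  moreover have "(\<Sum>i\<in>I. \<bar>l i\<bar>) = \<bar>l j\<bar> + (\<Sum>i\<in>I-{j}. \<bar>l i\<bar>)"
    using assms by (simp add: sum.remove[of I j])
  ultimately show ?thesis using assms(3) by simp
qed

text \<open>Interpolation between the l1 and the sup norm: \<open>abs_le_of_sum_zero\<close> bounds
  all but one power of each entry by \<open>P\<close>, and the remaining first powers add up to at
  most \<open>2 * P\<close>.\<close>

lemma lp_norm_le_of_sum_zero:
  fixes l :: "'a \<Rightarrow> real"
  assumes I: "finite I" and l: "(\<Sum>i\<in>I. l i) = 0" "(\<Sum>i\<in>I. \<bar>l i\<bar>) \<le> 2 * P" and p: "1 \<le> p"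
  shows "(\<Sum>i\<in>I. \<bar>l i\<bar> powr p) powr (1 / p) \<le> 2 powr (1 / p) * P"
proof -
  have "0 \<le> (\<Sum>i\<in>I. \<bar>l i\<bar>)" by (rule sum_nonneg) auto
  hence P: "0 \<le> P" using l by linarith
  have "\<bar>l i\<bar> powr p \<le> \<bar>l i\<bar> * P powr (p - 1)" if "i \<in> I" for i
  proof (cases "l i = 0")
    case False
    have "\<bar>l i\<bar> powr p = \<bar>l i\<bar> powr 1 * \<bar>l i\<bar> powr (p - 1)"
      by (subst powr_add[symmetric]) simp
    also have "\<dots> \<le> \<bar>l i\<bar> * P powr (p - 1)"
      using p abs_le_of_sum_zero[OF I l that] by (auto intro!: mult_left_mono powr_mono2)
    finally show ?thesis .
  qed auto
  hence "(\<Sum>i\<in>I. \<bar>l i\<bar> powr p) \<le> (\<Sum>i\<in>I. \<bar>l i\<bar>) * P powr (p - 1)"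
    unfolding sum_distrib_right by (rule sum_mono)
  also have "\<dots> \<le> 2 * P * P powr (p - 1)" using l by (intro mult_right_mono) auto
  also have "\<dots> = 2 * P powr p"
  proof (cases "P = 0")
    case False
    hence "P * P powr (p - 1) = P powr p"
      using P powr_add[of P 1 "p - 1"] by simp
    thus ?thesis by simp
  qed auto
  finally have "(\<Sum>i\<in>I. \<bar>l i\<bar> powr p) powr (1 / p) \<le> (2 * P powr p) powr (1 / p)"
    using p by (intro powr_mono2 sum_nonneg) auto
  also have "\<dots> = 2 powr (1 / p) * P"
    using p P by (simp add: powr_mult powr_powr)
  finally show ?thesis .
qed

text \<open>
  Replacing \<open>y\<close> by its component orthogonal to \<open>x\<close> changes the product only by a real number.
\<close>
lemma Im_twisted_inner_le:
  fixes x y :: "nat \<Rightarrow> complex" and s :: "nat \<Rightarrow> real"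
  assumes s: "\<And>m. m < n \<Longrightarrow> \<bar>s m\<bar> \<le> 1"
    and c: "c = (\<Sum>m<n. cnj (x m) * y m)"
  defines "A \<equiv> (\<Sum>m<n. (cmod (x m))\<^sup>2)" and "B \<equiv> (\<Sum>m<n. (cmod (y m))\<^sup>2)"
  shows "\<bar>Im (c * (\<Sum>m<n. of_real (s m) * x m * cnj (y m)))\<bar> \<le> cmod c * sqrt (A * B - (cmod c)\<^sup>2)"
    and "(cmod c)\<^sup>2 \<le> A * B"
proof -
  have A0: "0 \<le> A" unfolding A_def by (intro sum_nonneg) auto
  \<comment> \<open>Both claims come from one orthogonal decomposition, which divides by
    \<open>A\<close>; hence the case split.\<close>
  have "\<bar>Im (c * (\<Sum>m<n. of_real (s m) * x m * cnj (y m)))\<bar> \<le> cmod c * sqrt (A * B - (cmod c)\<^sup>2)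
     \<and> (cmod c)\<^sup>2 \<le> A * B"
  proof (cases "A = 0")
    case True
    hence "\<And>m. m < n \<Longrightarrow> x m = 0" unfolding A_def by (subst (asm) sum_nonneg_eq_0_iff) auto
    thus ?thesis using c True by simp
  next
    case False
    with A0 have A: "A > 0" by simp
    have Ac: "(\<Sum>m<n. x m * cnj (x m)) = of_real A"
      unfolding A_def by (simp add: complex_norm_square[symmetric] of_real_sum)
    have Bc: "(\<Sum>m<n. y m * cnj (y m)) = of_real B"
      unfolding B_def by (simp add: complex_norm_square[symmetric] of_real_sum)
    have cc: "(\<Sum>m<n. x m * cnj (y m)) = cnj c" unfolding c by (simp add: cnj_sum)
    have c': "(\<Sum>m<n. y m * cnj (x m)) = c" unfolding c by (simp add: mult.commute)
    define w where "w m = y m - c / of_real A * x m" for m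
    \<comment> \<open>Pythagoras for the decomposition of \<open>y\<close> along
      \<open>x\<close>.\<close>
    have "complex_of_real (\<Sum>m<n. (cmod (w m))\<^sup>2) = (\<Sum>m<n. w m * cnj (w m))"
      by (simp add: complex_norm_square[symmetric] of_real_sum)
    also have "\<dots> = (\<Sum>m<n. y m * cnj (y m)) - cnj c / of_real A * (\<Sum>m<n. y m * cnj (x m))
       - c / of_real A * (\<Sum>m<n. x m * cnj (y m)) + c * cnj c / (of_real A)\<^sup>2 * (\<Sum>m<n. x m * cnj (x m))"
      unfolding w_def sum_distrib_left sum_subtractf[symmetric] sum.distrib[symmetric]
      by (intro sum.cong) (auto simp: algebra_simps power2_eq_square)
    also have "\<dots> = of_real B - c * cnj c / of_real A"
      unfolding Ac Bc cc c' using A by (simp add: field_simps power2_eq_square)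
    also have "\<dots> = of_real (B - (cmod c)\<^sup>2 / A)"
      by (simp add: complex_norm_square[symmetric])
    finally have W: "(\<Sum>m<n. (cmod (w m))\<^sup>2) = B - (cmod c)\<^sup>2 / A" 
      unfolding of_real_eq_iff .
    have W0: "0 \<le> (\<Sum>m<n. (cmod (w m))\<^sup>2)" by (intro sum_nonneg) auto
    let ?S = "\<Sum>m<n. s m * (cmod (x m))\<^sup>2" and ?T = "\<Sum>m<n. of_real (s m) * x m * cnj (w m)"
    have yw: "y m = w m + c / of_real A * x m" for m unfolding w_def by simp
    have "(\<Sum>m<n. of_real (s m) * x m * cnj (y m)) = ?T + cnj c / of_real A * (\<Sum>m<n. of_real (s m) * (x m * cnj (x m)))"
      unfolding yw sum_distrib_left sum.distrib[symmetric] by (intro sum.cong) (auto simp: algebra_simps)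
    also have "(\<Sum>m<n. of_real (s m) * (x m * cnj (x m))) = of_real ?S"
      by (simp add: complex_norm_square[symmetric] of_real_sum)
    finally have "c * (\<Sum>m<n. of_real (s m) * x m * cnj (y m)) = c * ?T + of_real ((cmod c)\<^sup>2 / A * ?S)"
      using complex_norm_square[of c] by (simp add: algebra_simps)
    hence "Im (c * (\<Sum>m<n. of_real (s m) * x m * cnj (y m))) = Im (c * ?T)" by simp
    also have "\<bar>\<dots>\<bar> \<le> cmod c * cmod ?T" using abs_Im_le_cmod[of "c * ?T"] by (simp add: norm_mult)
    also have "\<dots> \<le> cmod c * sqrt (A * B - (cmod c)\<^sup>2)"
    proof (rule mult_left_mono)
      have "cmod ?T \<le> (\<Sum>m<n. cmod (of_real (s m) * x m * cnj (w m)))" by (rule norm_sum)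
      also have "\<dots> \<le> (\<Sum>m<n. sqrt ((cmod (x m))\<^sup>2) * sqrt ((cmod (w m))\<^sup>2))"
        using s by (intro sum_mono) (auto simp: norm_mult mult.assoc intro!: mult_left_le_one_le)
      also have "\<dots> \<le> sqrt A * sqrt (\<Sum>m<n. (cmod (w m))\<^sup>2)"
        unfolding A_def by (rule sum_mult_le_sqrt) auto
      also have "\<dots> = sqrt (A * B - (cmod c)\<^sup>2)"
        unfolding W real_sqrt_mult[symmetric] using A by (simp add: right_diff_distrib)
      finally show "cmod ?T \<le> sqrt (A * B - (cmod c)\<^sup>2)" .
    qed auto
    \<comment> \<open>Non-negativity of the squared norm of \<open>w\<close> is the second
      claim.\<close>
    finally show ?thesis using W0 A unfolding W by (simp add: field_simps)
  qed
  thus "\<bar>Im (c * (\<Sum>m<n. of_real (s m) * x m * cnj (y m)))\<bar> \<le> cmod c * sqrt (A * B - (cmod c)\<^sup>2)"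
    and "(cmod c)\<^sup>2 \<le> A * B" by auto
qed

section \<open>Singular values and traces\<close>

text \<open>The characteristic polynomial is invariant under similarity and splits along the
  diagonal of a triangular matrix, so the multiset of roots can be read off there.\<close>

lemma singular_values_similar:
  assumes "similar_mat (mat_adjoint K * K) B" "B \<in> carrier_mat n n" "upper_triangular B"
  shows "singular_values K = image_mset (\<lambda>i. sqrt (Re (B $$ (i, i)))) (mset_set {..<n})"
proof -
  have "char_poly (mat_adjoint K * K) = (\<Prod>a\<leftarrow>diag_mat B. [:- a, 1:])"
    using char_poly_similar[OF assms(1)] char_poly_upper_triangular[OF assms(2,3)] by simp
  moreover have "proots (\<Prod>a\<leftarrow>as. [:- a, 1:]) = mset as" for as :: "complex list"
  proof (induction as)
    case (Cons a as)
    have "(\<Prod>a\<leftarrow>as. [:- a, 1:]) \<noteq> 0" by (auto simp: prod_list_zero_iff)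
    from proots_mult[OF _ this, of "[:- a, 1:]"] show ?case using Cons by (simp del: mult_pCons_left)
  qed simp
  ultimately have "proots (char_poly (mat_adjoint K * K)) = mset (diag_mat B)" by simp
  also have "mset (diag_mat B) = image_mset (\<lambda>i. B $$ (i, i)) (mset_set {..<n})"
    using assms(2) by (auto simp: diag_mat_def mset_map lessThan_atLeast0)
  finally show ?thesis unfolding singular_values_def by (simp add: image_mset.compositionality o_def)
qed

text \<open>The imaginary unit times \<open>K\<close> is Hermitian, so the spectral theorem applies.
  In the resulting basis \<open>mat_adjoint K * K\<close> is diagonal with entries
  \<open>(l i)\<^sup>2\<close>, whose square roots are the singular values.\<close>

lemma anti_hermitian_diagonalization:
  fixes K :: "complex mat"
  assumes K: "K \<in> carrier_mat n n" and Ka: "mat_adjoint K = - K"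
  obtains U l where "unitary_mat n U"
    "mat_adjoint U * K * U = mat_diag n (\<lambda>i. \<i> * complex_of_real (l i))"
    "singular_values K = image_mset (\<lambda>i. \<bar>l i\<bar>) (mset_set {..<n})"
proof -
  define H where "H = \<i> \<cdot>\<^sub>m K"
  have H: "H \<in> carrier_mat n n" unfolding H_def using K by auto
  have Hh: "mat_adjoint H = H"
  proof (rule eq_matI)
    fix i j assume "i < dim_row H" "j < dim_col H"
    hence i: "i < n" and j: "j < n" using H by auto
    have "cnj (K $$ (j, i)) = - K $$ (i, j)"
      using arg_cong[OF Ka, of "\<lambda>M. M $$ (i, j)"] K i j by simp
    thus "mat_adjoint H $$ (i, j) = H $$ (i, j)" using K i j unfolding H_def by simp
  qed (use H in auto)
  obtain U where U: "unitary_mat n U" "diagonal_mat (mat_adjoint U * H * U)"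
    using hermitian_diagonalization[OF H Hh] .
  note UD = unitary_matD[OF U(1)]
  define D where "D = mat_adjoint U * H * U"
  have D: "D \<in> carrier_mat n n" unfolding D_def using UD H by auto
  have Dh: "mat_adjoint D = D" unfolding D_def by (rule unitary_conj_hermitian[OF UD(1) H Hh])
  define L where "L = mat_adjoint U * K * U"
  have L: "L \<in> carrier_mat n n" unfolding L_def using UD K by auto
  have DL: "D = \<i> \<cdot>\<^sub>m L" unfolding D_def L_def H_def using UD K
    by (simp add: mult_smult_distrib[of _ n n _ n] mult_smult_assoc_mat[of _ n n _ n] mult_carrier_mat[of _ n n _ n])
  \<comment> \<open>The sign comes from solving \<open>D = \<i> \<cdot>\<^sub>m L\<close> for
    \<open>L\<close>: the inverse of the imaginary unit is its negative.\<close>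
  define l where "l i = - Re (D $$ (i, i))" for i
  have Lm: "L = mat_diag n (\<lambda>i. \<i> * complex_of_real (l i))"
  proof (rule eq_matI)
    fix i j assume "i < dim_row (mat_diag n (\<lambda>i. \<i> * complex_of_real (l i)))"
      "j < dim_col (mat_diag n (\<lambda>i. \<i> * complex_of_real (l i)))"
    hence i: "i < n" and j: "j < n" by (auto simp: mat_diag_def)
    have LD: "L $$ (i, j) = - \<i> * D $$ (i, j)" unfolding DL using L i j by simp
    have "D $$ (i, j) = 0" if "i \<noteq> j"
      using U(2) D that i j unfolding D_def[symmetric] diagonal_mat_def by auto
    moreover have "D $$ (i, i) = complex_of_real (Re (D $$ (i, i)))"
      using arg_cong[OF Dh, of "\<lambda>M. M $$ (i, i)"] D i by (auto simp: complex_eq_iff)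
    ultimately show "L $$ (i, j) = mat_diag n (\<lambda>i. \<i> * complex_of_real (l i)) $$ (i, j)"
      using i j LD by (auto simp: l_def mat_diag_def)
  qed (use L in \<open>auto simp: mat_diag_def\<close>)
  define B where "B = mat_diag n (\<lambda>i. complex_of_real ((l i)\<^sup>2))"
  have B: "B \<in> carrier_mat n n" unfolding B_def by simp
  have ut: "upper_triangular B" unfolding B_def mat_diag_def by (auto simp: upper_triangular_def)
  have "mat_adjoint L = mat_diag n (\<lambda>i. - \<i> * complex_of_real (l i))"
    unfolding Lm by (intro eq_matI) (auto simp: mat_diag_def)
  hence BL: "B = mat_adjoint L * L"
    unfolding B_def by (simp add: Lm mult_ac power2_eq_square flip: of_real_mult)
  have La: "mat_adjoint L = mat_adjoint U * mat_adjoint K * U"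
  proof -
    have "mat_adjoint L = mat_adjoint U * mat_adjoint (mat_adjoint U * K)"
      unfolding L_def using UD K by (subst mat_adjoint_mult[of _ n n _ n]) auto
    also have "mat_adjoint (mat_adjoint U * K) = mat_adjoint K * U"
      using UD K by (subst mat_adjoint_mult[of _ n n _ n]) auto
    finally show ?thesis using UD K by (simp add: assoc_mult_mat[of _ n n _ n _ n])
  qed
  have cancel: "U * (mat_adjoint U * M) = M" if "M \<in> carrier_mat n n" for M
    using UD that by (subst assoc_mult_mat[of _ n n _ n _ n, symmetric]) auto
  have "mat_adjoint K * K = U * B * mat_adjoint U"
    unfolding BL La unfolding L_def using UD K cancel
    by (simp add: assoc_mult_mat[of _ n n _ n _ n] mult_carrier_mat[of _ n n _ n])
  hence "similar_mat (mat_adjoint K * K) B"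
    unfolding similar_mat_def using UD K B
    by (intro exI) (rule similar_mat_witI[of U "mat_adjoint U" n], auto simp del: assoc_mult_mat)
  note singular_values_similar[OF this B ut]
  also have "image_mset (\<lambda>i. sqrt (Re (B $$ (i, i)))) (mset_set {..<n}) = image_mset (\<lambda>i. \<bar>l i\<bar>) (mset_set {..<n})"
    by (rule image_mset_cong) (auto simp: B_def mat_diag_def simp flip: of_real_power)
  finally have "singular_values K = image_mset (\<lambda>i. \<bar>l i\<bar>) (mset_set {..<n})" .
  with U(1) Lm that show ?thesis unfolding L_def by blast
qed

text \<open>For infinite \<open>p\<close> only the bound on single entries enters, without a factor
  2, and \<open>1 \<le> n\<close> makes the maximum range over a non-empty set.\<close>

lemma schatten_norm_le:
  fixes n :: nat
  assumes sv: "singular_values K = image_mset (\<lambda>i. \<bar>l i\<bar>) (mset_set {..<n})"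
    and l: "(\<Sum>i<n. l i) = 0" "(\<Sum>i<n. \<bar>l i\<bar>) \<le> 2 * P"
    and p: "1 \<le> p" and n: "1 \<le> n"
  shows "schatten_norm p K \<le> two_powr_inverse p * P"
proof (cases "p = \<infinity>")
  case True
  have "\<bar>l i\<bar> \<le> P" if "i < n" for i
    using abs_le_of_sum_zero[OF finite_lessThan l] that by auto
  hence "Max ((\<lambda>i. \<bar>l i\<bar>) ` {..<n}) \<le> P" using n by (subst Max_le_iff) (auto simp: lessThan_empty_iff)
  thus ?thesis unfolding schatten_norm_def two_powr_inverse_def sv using True by simp
next
  case False
  hence "1 \<le> real_of_ereal p" using p by (cases p) auto
  from lp_norm_le_of_sum_zero[of "{..<n}" l P, OF _ l this] show ?thesis
    unfolding schatten_norm_def two_powr_inverse_def sv using False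
    by (simp add: image_mset.compositionality o_def sum_unfold_sum_mset)
qed

section \<open>Traces, and factorization of positive operators\<close>

definition mat_trace :: "complex mat \<Rightarrow> complex" where
  "mat_trace A = (\<Sum>i<dim_row A. A $$ (i, i))"

lemma mat_trace_mult:
  assumes "A \<in> carrier_mat n m" "B \<in> carrier_mat m n"
  shows "mat_trace (A * B) = (\<Sum>i<n. \<Sum>j<m. A $$ (i, j) * B $$ (j, i))"
  unfolding mat_trace_def using assms
  by (intro sum.cong) (auto simp: index_mult_mat_sum[OF assms] simp del: index_mult_mat(1))

lemma mat_trace_comm:
  assumes "A \<in> carrier_mat n m" "B \<in> carrier_mat m n"
  shows "mat_trace (A * B) = mat_trace (B * A)"
  unfolding mat_trace_mult[OF assms] mat_trace_mult[OF assms(2,1)]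
  by (subst sum.swap) (simp add: mult.commute)

lemma mat_trace_unitary:
  assumes "unitary_mat n U" "A \<in> carrier_mat n n"
  shows "mat_trace (mat_adjoint U * A * U) = mat_trace A"
proof -
  note U = unitary_matD[OF assms(1)]
  have "mat_trace (mat_adjoint U * A * U) = mat_trace (U * (mat_adjoint U * A))"
    using U assms(2) by (subst mat_trace_comm[of _ n n]) auto
  also have "U * (mat_adjoint U * A) = A"
    using U assms(2) by (subst assoc_mult_mat[of _ n n _ n _ n, symmetric]) auto
  finally show ?thesis .
qed

lemma mat_trace_mult_adjoint:
  assumes "X \<in> carrier_mat n m"
  shows "mat_trace (X * mat_adjoint X) = complex_of_real (\<Sum>i<n. \<Sum>j<m. (cmod (X $$ (i, j)))\<^sup>2)"
proof -
  have "mat_trace (X * mat_adjoint X) = (\<Sum>i<n. \<Sum>j<m. X $$ (i, j) * cnj (X $$ (i, j)))"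
    using assms by (subst mat_trace_mult[of _ n m]) (auto intro!: sum.cong)
  thus ?thesis by (simp add: complex_norm_square[symmetric])
qed

text \<open>The columns of \<open>X\<close> are the vectors of a decomposition of \<open>E\<close>
  into rank-one operators. They arise from the square root of the diagonal form of \<open>E\<close>,
  carried back by \<open>U\<close>.\<close>

lemma positive_semidefinite_factorization:
  assumes "positive_semidefinite n E"
  obtains X where "X \<in> carrier_mat n n" "E = X * mat_adjoint X"
proof -
  have E: "E \<in> carrier_mat n n" and Eh: "mat_adjoint E = E"
    and pos: "\<And>v. v \<in> carrier_vec n \<Longrightarrow> 0 \<le> Re ((E *\<^sub>v v) \<bullet>c v)"
    using assms unfolding positive_semidefinite_def by auto
  obtain U where U: "unitary_mat n U" "diagonal_mat (mat_adjoint U * E * U)"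
    using hermitian_diagonalization[OF E Eh] .
  note UD = unitary_matD[OF U(1)]
  define D where "D = mat_adjoint U * E * U"
  have D: "D \<in> carrier_mat n n" unfolding D_def using UD E by auto
  have Dh: "mat_adjoint D = D" unfolding D_def by (rule unitary_conj_hermitian[OF UD(1) E Eh])
  \<comment> \<open>A diagonal entry of \<open>D\<close> is the quadratic form of \<open>E\<close>
    at a column of \<open>U\<close>.\<close>
  have Dpos: "0 \<le> Re (D $$ (i, i))" if i: "i < n" for i
  proof -
    have "D $$ (i, i) = row (mat_adjoint U) i \<bullet> col (E * U) i"
      unfolding D_def using UD E i by (simp add: assoc_mult_mat[of _ n n _ n _ n])
    also have "col (E * U) i = E *\<^sub>v col U i"
      using UD E i by (subst col_mult2[of _ n n _ n]) auto
    also have "row (mat_adjoint U) i = conjugate (col U i)"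
      using UD i by (intro eq_vecI) auto
    also have "\<dots> \<bullet> (E *\<^sub>v col U i) = (E *\<^sub>v col U i) \<bullet>c col U i"
      using UD E i by (subst comm_scalar_prod[of _ n]) auto
    finally show ?thesis using pos[of "col U i"] UD i by auto
  qed
  define S where "S = mat_diag n (\<lambda>i. complex_of_real (sqrt (Re (D $$ (i, i)))))"
  have S: "S \<in> carrier_mat n n" unfolding S_def by auto
  have Sa: "mat_adjoint S = S" by (intro eq_matI) (auto simp: S_def mat_diag_def)
  have "S * S = mat_diag n (\<lambda>i. complex_of_real (sqrt (Re (D $$ (i, i))) * sqrt (Re (D $$ (i, i)))))"
    unfolding S_def mat_diag_diag of_real_mult ..
  also have "\<dots> = D"
  proof (rule eq_matI)
    fix i j assume "i < dim_row D" "j < dim_col D"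
    hence i: "i < n" and j: "j < n" using D by auto
    show "mat_diag n (\<lambda>i. complex_of_real (sqrt (Re (D $$ (i, i))) * sqrt (Re (D $$ (i, i))))) $$ (i, j) = D $$ (i, j)"
      using U(2) D i j Dpos[OF j] arg_cong[OF Dh, of "\<lambda>M. M $$ (j, j)"] unfolding D_def[symmetric] diagonal_mat_def
      by (auto simp: complex_eq_iff mat_diag_def)
  qed (use D in \<open>auto simp: mat_diag_def\<close>)
  finally have SS: "S * S = D" .
  have cancel: "U * (mat_adjoint U * M) = M" if "M \<in> carrier_mat n n" for M
    using UD that by (subst assoc_mult_mat[of _ n n _ n _ n, symmetric]) auto
  have "U * S * mat_adjoint (U * S) = U * (S * S) * mat_adjoint U"
    using UD S Sa by (simp add: mat_adjoint_mult[of _ n n _ n] assoc_mult_mat[of _ n n _ n _ n]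
      mult_carrier_mat[of _ n n _ n])
  also have "\<dots> = E" unfolding SS D_def using UD E cancel
    by (simp add: assoc_mult_mat[of _ n n _ n _ n] mult_carrier_mat[of _ n n _ n])
  finally show ?thesis using that[of "U * S"] UD S by auto
qed

section \<open>The upper bound\<close>

lemma mat_adjoint_minus:
  fixes A :: "complex mat"
  assumes "A \<in> carrier_mat n m" "B \<in> carrier_mat n m"
  shows "mat_adjoint (A - B) = mat_adjoint A - mat_adjoint B"
  using assms by (intro eq_matI) auto

lemma commutator_carrier:
  "A \<in> carrier_mat n n \<Longrightarrow> B \<in> carrier_mat n n \<Longrightarrow> commutator A B \<in> carrier_mat n n"
  unfolding commutator_def by (intro minus_carrier_mat mult_carrier_mat)

lemma mat_adjoint_commutator:
  assumes "A \<in> carrier_mat n n" "B \<in> carrier_mat n n" "mat_adjoint A = A" "mat_adjoint B = B"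
  shows "mat_adjoint (commutator A B) = - commutator A B"
proof -
  have "mat_adjoint (commutator A B) = B * A - A * B"
    unfolding commutator_def using assms
    by (simp add: mat_adjoint_minus[of _ n n] mat_adjoint_mult[of _ n n _ n] mult_carrier_mat[of _ n n _ n])
  also have "\<dots> = - commutator A B"
    unfolding commutator_def using assms by (intro eq_matI) (auto simp del: index_mult_mat(1))
  finally show ?thesis .
qed

text \<open>In the eigenbasis of the commutator, \<open>l\<close> is twice the imaginary part of the
  diagonal of \<open>E * F\<close>. Factorizing both operators expands this diagonal into products
  of inner products, to which \<open>Im_twisted_inner_le\<close> applies with the signs of
  \<open>l\<close> as weights.\<close>

lemma commutator_diagonal_bound:
  assumes E: "positive_semidefinite n E" and F: "positive_semidefinite n F"
    and U: "unitary_mat n U"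
    and L: "mat_adjoint U * commutator E F * U = mat_diag n (\<lambda>i. \<i> * complex_of_real (l i))"
  defines "t \<equiv> Re (mat_trace (E * F))" and "a \<equiv> Re (mat_trace E)" and "b \<equiv> Re (mat_trace F)"
  shows "(\<Sum>m<n. l m) = 0" "0 \<le> t" "t \<le> a * b"
    "(\<Sum>m<n. \<bar>l m\<bar>) \<le> 2 * (sqrt t * sqrt (a * b - t))"
proof -
  note UD = unitary_matD[OF U]
  have Ec: "E \<in> carrier_mat n n" and Fc: "F \<in> carrier_mat n n"
    and Ea: "mat_adjoint E = E" and Fa: "mat_adjoint F = F"
    using E F unfolding positive_semidefinite_def by auto
  obtain X where X: "X \<in> carrier_mat n n" "E = X * mat_adjoint X"
    using positive_semidefinite_factorization[OF E] .
  obtain Y where Y: "Y \<in> carrier_mat n n" "F = Y * mat_adjoint Y"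
    using positive_semidefinite_factorization[OF F] .
  note sq = mat_adjoint_mult[of _ n n _ n] assoc_mult_mat[of _ n n _ n _ n] mult_carrier_mat[of _ n n _ n]
  have cancel: "U * (mat_adjoint U * M) = M" if "M \<in> carrier_mat n n" for M
    using UD that by (subst assoc_mult_mat[of _ n n _ n _ n, symmetric]) auto
  \<comment> \<open>The columns of \<open>G\<close> and \<open>H\<close> are the rank-one vectors of
    \<open>E\<close> and \<open>F\<close> in the eigenbasis of the commutator. \<open>C\<close>
    holds their mutual inner products, which by \<open>CGH\<close> are the same in both
    bases.\<close>
  define G where "G = mat_adjoint U * X"
  define H where "H = mat_adjoint U * Y"
  define C where "C = mat_adjoint X * Y"
  have car: "G \<in> carrier_mat n n" "H \<in> carrier_mat n n" "C \<in> carrier_mat n n"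
    unfolding G_def H_def C_def using UD X(1) Y(1) by auto
  have CGH: "C = mat_adjoint G * H"
    unfolding G_def H_def C_def using UD X(1) Y(1) by (simp add: sq cancel)
  define M where "M = G * (C * mat_adjoint H)"
  have M: "M \<in> carrier_mat n n" unfolding M_def using car by auto
  have MEF: "M = mat_adjoint U * (E * F) * U"
    unfolding M_def G_def H_def C_def X(2) Y(2) using UD X(1) Y(1) by (simp add: sq)
  have "mat_adjoint M = mat_adjoint U * mat_adjoint (mat_adjoint U * (E * F))"
    unfolding MEF using UD Ec Fc by (subst mat_adjoint_mult[of _ n n _ n]) auto
  also have "\<dots> = mat_adjoint U * (F * E) * U"
    using UD Ec Fc Ea Fa by (simp add: sq)
  finally have MFE: "mat_adjoint M = mat_adjoint U * (F * E) * U" .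
  \<comment> \<open>\<open>F * E\<close> is the adjoint of \<open>E * F\<close>, so the diagonal of
    the commutator is a difference of conjugate numbers.\<close>
  have "mat_adjoint U * commutator E F * U = M - mat_adjoint M"
    unfolding commutator_def MFE unfolding MEF using UD Ec Fc
    by (simp add: mult_minus_distrib_mat[of _ n n _ n] minus_mult_distrib_mat[of _ n n _ _ n] 
      mult_carrier_mat[of _ n n _ n] minus_carrier_mat del: assoc_mult_mat)
  hence lM: "l m = 2 * Im (M $$ (m, m))" if "m < n" for m
    using arg_cong[OF L, of "\<lambda>M. Im (M $$ (m, m))"] M that by (simp add: mat_diag_def)
  have Mm: "M $$ (m, m) = (\<Sum>j<n. \<Sum>k<n. C $$ (j, k) * (G $$ (m, j) * cnj (H $$ (m, k))))" if m: "m < n" for m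
  proof -
    have "M $$ (m, m) = (\<Sum>j<n. G $$ (m, j) * (C * mat_adjoint H) $$ (j, m))"
      unfolding M_def using car m by (intro index_mult_mat_sum) auto
    also have "\<dots> = (\<Sum>j<n. \<Sum>k<n. C $$ (j, k) * (G $$ (m, j) * cnj (H $$ (m, k))))"
    proof (rule sum.cong)
      fix j assume j: "j \<in> {..<n}"
      have "(C * mat_adjoint H) $$ (j, m) = (\<Sum>k<n. C $$ (j, k) * mat_adjoint H $$ (k, m))"
        using car m j by (intro index_mult_mat_sum) auto
      also have "\<dots> = (\<Sum>k<n. C $$ (j, k) * cnj (H $$ (m, k)))"
        using car m by (intro sum.cong) auto
      finally show "G $$ (m, j) * (C * mat_adjoint H) $$ (j, m)
          = (\<Sum>k<n. C $$ (j, k) * (G $$ (m, j) * cnj (H $$ (m, k))))"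
        by (simp add: sum_distrib_left mult_ac)
    qed simp
    finally show ?thesis .
  qed
  \<comment> \<open>The weights stay general: constant weight 1 gives the trace of \<open>M\<close>,
    the signs of \<open>l\<close> give the sum of the \<open>\<bar>l m\<bar>\<close>.\<close>
  have twist: "(\<Sum>m<n. complex_of_real (s m) * M $$ (m, m))
      = (\<Sum>j<n. \<Sum>k<n. C $$ (j, k) * (\<Sum>m<n. complex_of_real (s m) * G $$ (m, j) * cnj (H $$ (m, k))))" for s
  proof -
    have "(\<Sum>m<n. complex_of_real (s m) * M $$ (m, m))
      = (\<Sum>m<n. \<Sum>j<n. \<Sum>k<n. C $$ (j, k) * (complex_of_real (s m) * G $$ (m, j) * cnj (H $$ (m, k))))"
      by (intro sum.cong) (auto simp: Mm sum_distrib_left mult_ac)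
    also have "\<dots> = (\<Sum>j<n. \<Sum>m<n. \<Sum>k<n. C $$ (j, k) * (complex_of_real (s m) * G $$ (m, j) * cnj (H $$ (m, k))))"
      by (rule sum.swap)
    also have "\<dots> = (\<Sum>j<n. \<Sum>k<n. \<Sum>m<n. C $$ (j, k) * (complex_of_real (s m) * G $$ (m, j) * cnj (H $$ (m, k))))"
      by (intro sum.cong refl sum.swap)
    finally show ?thesis by (simp add: sum_distrib_left)
  qed
  have Cjk: "C $$ (j, k) = (\<Sum>m<n. cnj (G $$ (m, j)) * H $$ (m, k))" if "j < n" "k < n" for j k
    unfolding CGH using car that by (subst index_mult_mat_sum[of _ n n _ n]) (auto intro!: sum.cong)
  \<comment> \<open>\<open>T\<close> is a real, non-negative value of the trace of \<open>M\<close>.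
    Its being real makes the \<open>l m\<close> sum to zero.\<close>
  define T where "T = (\<Sum>j<n. \<Sum>k<n. (cmod (C $$ (j, k)))\<^sup>2)"
  have "(\<Sum>m<n. M $$ (m, m)) = (\<Sum>j<n. \<Sum>k<n. C $$ (j, k) * cnj (C $$ (j, k)))"
    using twist[of "\<lambda>_. 1"] by (simp add: Cjk mult.commute)
  hence trM: "(\<Sum>m<n. M $$ (m, m)) = complex_of_real T"
    unfolding T_def by (simp add: complex_norm_square[symmetric])
  have "mat_trace M = mat_trace (E * F)" unfolding MEF
    using Ec Fc by (intro mat_trace_unitary[OF U]) auto
  hence "mat_trace (E * F) = complex_of_real T" using trM M unfolding mat_trace_def[of M] by simp
  hence tT: "t = T" unfolding t_def by simp
  show "(\<Sum>m<n. l m) = 0"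
    using arg_cong[OF trM, of Im] by (simp add: lM sum_distrib_left[symmetric])
  show t0: "0 \<le> t" unfolding tT T_def by (intro sum_nonneg) auto
  define A where "A j = (\<Sum>m<n. (cmod (G $$ (m, j)))\<^sup>2)" for j
  define B where "B k = (\<Sum>m<n. (cmod (H $$ (m, k)))\<^sup>2)" for k
  \<comment> \<open>By unitary invariance the trace of \<open>E\<close> is the total squared length
    of the columns of \<open>G\<close>.\<close>
  have "mat_adjoint U * E * U = G * mat_adjoint G" 
    unfolding G_def X(2) using UD X(1) by (simp add: sq)
  hence "a = Re (mat_trace (G * mat_adjoint G))"
    using mat_trace_unitary[OF U Ec] unfolding a_def by simp
  hence aA: "a = (\<Sum>j<n. A j)"
    unfolding A_def mat_trace_mult_adjoint[OF car(1)] Re_complex_of_real by (subst sum.swap) simp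
  have "mat_adjoint U * F * U = H * mat_adjoint H" 
    unfolding H_def Y(2) using UD Y(1) by (simp add: sq)
  hence "b = Re (mat_trace (H * mat_adjoint H))"
    using mat_trace_unitary[OF U Fc] unfolding b_def by simp
  hence bB: "b = (\<Sum>k<n. B k)"
    unfolding B_def mat_trace_mult_adjoint[OF car(2)] Re_complex_of_real by (subst sum.swap) simp
  have ab: "a * b = (\<Sum>j<n. \<Sum>k<n. A j * B k)" unfolding aA bB by (rule sum_product)
  \<comment> \<open>The zero weights are a placeholder; the second claim of the lemma is plain
    Cauchy-Schwarz.\<close>
  have CS: "(cmod (C $$ (j, k)))\<^sup>2 \<le> A j * B k" if "j < n" "k < n" for j k
    unfolding A_def B_def by (rule Im_twisted_inner_le(2)[of n "\<lambda>_. 0"]) (use Cjk[OF that] in auto)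
  show tab: "t \<le> a * b" unfolding tT T_def ab using CS by (intro sum_mono) auto
  define s where "s m = (if l m \<ge> 0 then 1 else - 1 :: real)" for m
  have "(\<Sum>m<n. \<bar>l m\<bar>) = 2 * Im (\<Sum>m<n. complex_of_real (s m) * M $$ (m, m))"
    unfolding Im_sum sum_distrib_left by (intro sum.cong) (auto simp: s_def lM)
  also have "\<dots> = 2 * (\<Sum>j<n. \<Sum>k<n. Im (C $$ (j, k) *
      (\<Sum>m<n. complex_of_real (s m) * G $$ (m, j) * cnj (H $$ (m, k)))))"
    unfolding twist by (simp only: Im_sum)
  also have "(\<Sum>j<n. \<Sum>k<n. Im (C $$ (j, k) *
      (\<Sum>m<n. complex_of_real (s m) * G $$ (m, j) * cnj (H $$ (m, k)))))
    \<le> (\<Sum>j<n. \<Sum>k<n. sqrt ((cmod (C $$ (j, k)))\<^sup>2) * sqrt (A j * B k - (cmod (C $$ (j, k)))\<^sup>2))"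
  proof (intro sum_mono)
    fix j k assume jk: "j \<in> {..<n}" "k \<in> {..<n}"
    have "\<bar>Im (C $$ (j, k) * (\<Sum>m<n. complex_of_real (s m) * G $$ (m, j) * cnj (H $$ (m, k))))\<bar>
       \<le> cmod (C $$ (j, k)) * sqrt (A j * B k - (cmod (C $$ (j, k)))\<^sup>2)"
      unfolding A_def B_def by (rule Im_twisted_inner_le(1)) (use Cjk jk in \<open>auto simp: s_def\<close>)
    thus "Im (C $$ (j, k) * (\<Sum>m<n. complex_of_real (s m) * G $$ (m, j) * cnj (H $$ (m, k))))
       \<le> sqrt ((cmod (C $$ (j, k)))\<^sup>2) * sqrt (A j * B k - (cmod (C $$ (j, k)))\<^sup>2)"
      by (simp add: abs_le_iff)
  qed
  \<comment> \<open>Cauchy-Schwarz over the pairs \<open>(j, k)\<close>, flattened into a single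
    sum; by \<open>ab\<close> the second factor totals \<open>a * b - t\<close>.\<close>
  also have "\<dots> \<le> sqrt t * sqrt (a * b - t)"
    unfolding tT T_def ab sum.cartesian_product sum_subtractf[symmetric] split_def
    by (rule sum_mult_le_sqrt) (auto simp: CS)
  finally show "(\<Sum>m<n. \<bar>l m\<bar>) \<le> 2 * (sqrt t * sqrt (a * b - t))" by simp
qed

text \<open>Apart from the factor in \<open>p\<close>, only traces of \<open>E\<close>,
  \<open>F\<close> and \<open>E * F\<close> are left in the bound, and their totals over the
  outcomes are known.\<close>

lemma commutator_schatten_norm_le:
  assumes E: "positive_semidefinite n E" and F: "positive_semidefinite n F"
    and p: "1 \<le> p" and n: "1 \<le> n"
  defines "t \<equiv> Re (mat_trace (E * F))" and "ab \<equiv> Re (mat_trace E) * Re (mat_trace F)"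
  shows "0 \<le> t" "t \<le> ab"
    "schatten_norm p (commutator E F) \<le> two_powr_inverse p * (sqrt t * sqrt (ab - t))"
proof -
  have Ec: "E \<in> carrier_mat n n" and Fc: "F \<in> carrier_mat n n"
    and Ea: "mat_adjoint E = E" and Fa: "mat_adjoint F = F"
    using E F unfolding positive_semidefinite_def by auto
  obtain U l where U: "unitary_mat n U"
    and L: "mat_adjoint U * commutator E F * U = mat_diag n (\<lambda>i. \<i> * complex_of_real (l i))"
    and sv: "singular_values (commutator E F) = image_mset (\<lambda>i. \<bar>l i\<bar>) (mset_set {..<n})"
    using anti_hermitian_diagonalization[OF commutator_carrier[OF Ec Fc] mat_adjoint_commutator[OF Ec Fc Ea Fa]] .
  note * = commutator_diagonal_bound[OF E F U L, folded t_def ab_def]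
  show "0 \<le> t" "t \<le> ab" by fact+
  show "schatten_norm p (commutator E F) \<le> two_powr_inverse p * (sqrt t * sqrt (ab - t))"
    using schatten_norm_le[OF sv *(1,4) p n] .
qed

section \<open>Summation over the outcomes\<close>

lemma measurement_traces:
  assumes E: "is_measurement n k E"
  shows "\<And>a. a \<in> {1..k} \<Longrightarrow> positive_semidefinite n (E a)"
    and "\<And>a. a \<in> {1..k} \<Longrightarrow> E a \<in> carrier_mat n n"
    and "\<And>i j. i < n \<Longrightarrow> j < n \<Longrightarrow> (\<Sum>a=1..k. E a $$ (i, j)) = (if i = j then 1 else 0)"
    and "(\<Sum>a=1..k. mat_trace (E a)) = of_nat n"
proof -
  show "\<And>a. a \<in> {1..k} \<Longrightarrow> positive_semidefinite n (E a)" using E unfolding is_measurement_def by auto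
  thus c: "\<And>a. a \<in> {1..k} \<Longrightarrow> E a \<in> carrier_mat n n" unfolding positive_semidefinite_def by auto
  have *: "mat n n (\<lambda>(i, j). \<Sum>a=1..k. E a $$ (i, j)) = 1\<^sub>m n" using E unfolding is_measurement_def by auto
  show ij: "(\<Sum>a=1..k. E a $$ (i, j)) = (if i = j then 1 else 0)" if "i < n" "j < n" for i j
    using arg_cong[OF *, of "\<lambda>M. M $$ (i, j)"] that by simp
  have "(\<Sum>a=1..k. mat_trace (E a)) = (\<Sum>a=1..k. \<Sum>i<n. E a $$ (i, i))"
    unfolding mat_trace_def using c by (intro sum.cong) auto
  also have "\<dots> = (\<Sum>i<n. \<Sum>a=1..k. E a $$ (i, i))" by (rule sum.swap)
  also have "\<dots> = of_nat n" using ij by simp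
  finally show "(\<Sum>a=1..k. mat_trace (E a)) = of_nat n" .
qed

text \<open>By bilinearity the total is the trace of the product of two identity matrices.
  Entrywise, completeness of \<open>F\<close> leaves a Kronecker delta, and completeness of
  \<open>E\<close> then gives the trace.\<close>

lemma sum_trace_products:
  assumes E: "is_measurement n nE E" and F: "is_measurement n nF F"
  shows "(\<Sum>a=1..nE. \<Sum>b=1..nF. mat_trace (E a * F b)) = of_nat n"
proof -
  note e = measurement_traces[OF E] and f = measurement_traces[OF F]
  have "(\<Sum>a=1..nE. \<Sum>b=1..nF. mat_trace (E a * F b))
    = (\<Sum>a=1..nE. \<Sum>b=1..nF. \<Sum>i<n. \<Sum>j<n. E a $$ (i, j) * F b $$ (j, i))"
    using e(2) f(2) by (intro sum.cong refl mat_trace_mult)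
  also have "\<dots> = (\<Sum>a=1..nE. \<Sum>i<n. \<Sum>b=1..nF. \<Sum>j<n. E a $$ (i, j) * F b $$ (j, i))"
    by (intro sum.cong refl sum.swap)
  also have "\<dots> = (\<Sum>a=1..nE. \<Sum>i<n. \<Sum>j<n. \<Sum>b=1..nF. E a $$ (i, j) * F b $$ (j, i))"
    by (intro sum.cong refl sum.swap)
  also have "\<dots> = (\<Sum>a=1..nE. \<Sum>i<n. \<Sum>j<n. if j = i then E a $$ (i, i) else 0)"
    by (intro sum.cong refl) (auto simp: sum_distrib_left[symmetric] f(3) simp del: One_nat_def)
  also have "\<dots> = (\<Sum>a=1..nE. mat_trace (E a))"
    using e(2) by (intro sum.cong) (auto simp: mat_trace_def)
  finally show ?thesis using e(4) by simp
qed

text \<open>Cauchy-Schwarz over the pairs of outcomes reduces the sum of the single bounds to the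
  totals \<open>n\<close> and \<open>n * (n - 1)\<close>.\<close>

lemma Upsilon_le:
  assumes E: "is_measurement n nE E" and F: "is_measurement n nF F" and p: "1 \<le> p" and n: "1 \<le> n"
  shows "Upsilon p nE nF E F \<le> two_powr_inverse p * real n * sqrt (real n - 1)"
proof -
  note e = measurement_traces[OF E] and f = measurement_traces[OF F]
  define t where "t a b = Re (mat_trace (E a * F b))" for a b
  define x where "x a = Re (mat_trace (E a))" for a
  define y where "y b = Re (mat_trace (F b))" for b
  have bd: "0 \<le> t a b" "t a b \<le> x a * y b"
    "schatten_norm p (commutator (E a) (F b)) \<le> two_powr_inverse p * (sqrt (t a b) * sqrt (x a * y b - t a b))"
    if "a \<in> {1..nE}" "b \<in> {1..nF}" for a b
    unfolding t_def x_def y_def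
    using commutator_schatten_norm_le[OF e(1)[OF that(1)] f(1)[OF that(2)] p n] by auto
  have st: "(\<Sum>a=1..nE. \<Sum>b=1..nF. t a b) = real n"
    using arg_cong[OF sum_trace_products[OF E F], of Re] unfolding t_def by simp
  have sx: "(\<Sum>a=1..nE. x a) = real n" and sy: "(\<Sum>b=1..nF. y b) = real n"
    using arg_cong[OF e(4), of Re] arg_cong[OF f(4), of Re] unfolding x_def y_def by simp_all
  have "Upsilon p nE nF E F
     \<le> (\<Sum>a=1..nE. \<Sum>b=1..nF. two_powr_inverse p * (sqrt (t a b) * sqrt (x a * y b - t a b)))"
    unfolding Upsilon_def using bd(3) by (intro sum_mono) auto
  also have "\<dots> = two_powr_inverse p * (\<Sum>(a,b)\<in>{1..nE}\<times>{1..nF}. sqrt (t a b) * sqrt (x a * y b - t a b))"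
    unfolding sum_distrib_left[symmetric] sum.cartesian_product ..
  also have "\<dots> \<le> two_powr_inverse p * (sqrt (\<Sum>(a,b)\<in>{1..nE}\<times>{1..nF}. t a b)
      * sqrt (\<Sum>(a,b)\<in>{1..nE}\<times>{1..nF}. x a * y b - t a b))"
    unfolding split_def
    by (intro mult_left_mono sum_mult_le_sqrt) (auto simp: bd two_powr_inverse_def)
  also have "(\<Sum>(a,b)\<in>{1..nE}\<times>{1..nF}. t a b) = real n"
    unfolding sum.cartesian_product[symmetric] by (rule st)
  also have "(\<Sum>(a,b)\<in>{1..nE}\<times>{1..nF}. x a * y b - t a b) = real n * (real n - 1)"
    unfolding sum.cartesian_product[symmetric] sum_subtractf st sum_product[symmetric] sx sy
    by (simp add: algebra_simps)
  also have "two_powr_inverse p * (sqrt (real n) * sqrt (real n * (real n - 1)))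
      = two_powr_inverse p * real n * sqrt (real n - 1)"
    by (simp add: real_sqrt_mult)
  finally show ?thesis .
qed

section \<open>Mutually unbiased bases\<close>

definition outer_prod :: "complex vec \<Rightarrow> complex vec \<Rightarrow> complex mat" where
  "outer_prod v w = mat (dim_vec v) (dim_vec w) (\<lambda>(i, j). v $ i * cnj (w $ j))"

lemma outer_prod_carrier [simp]:
  "v \<in> carrier_vec n \<Longrightarrow> w \<in> carrier_vec m \<Longrightarrow> outer_prod v w \<in> carrier_mat n m"
  unfolding outer_prod_def by auto

lemma ket_bra_outer_prod: "ket_bra v = outer_prod v v"
  unfolding ket_bra_def outer_prod_def ..

text \<open>The scalar is the bra of \<open>v\<close> applied to the ket of \<open>w\<close>;
  \<open>\<bullet>c\<close> conjugates its second argument, hence the reversed order.\<close>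

lemma outer_prod_mult:
  assumes "u \<in> carrier_vec n" "v \<in> carrier_vec m" "w \<in> carrier_vec m" "x \<in> carrier_vec l"
  shows "outer_prod u v * outer_prod w x = (w \<bullet>c v) \<cdot>\<^sub>m outer_prod u x"
proof (rule eq_matI)
  fix i j assume "i < dim_row ((w \<bullet>c v) \<cdot>\<^sub>m outer_prod u x)" "j < dim_col ((w \<bullet>c v) \<cdot>\<^sub>m outer_prod u x)"
  hence ij: "i < n" "j < l" using assms by (auto simp: outer_prod_def)
  have "(outer_prod u v * outer_prod w x) $$ (i, j) = (\<Sum>k<m. (u $ i * cnj (v $ k)) * (w $ k * cnj (x $ j)))"
    using assms ij by (subst index_mult_mat_sum[of _ n m _ l]) (auto simp: outer_prod_def)
  also have "\<dots> = (w \<bullet>c v) * (u $ i * cnj (x $ j))"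
    using assms by (simp add: scalar_prod_def atLeast0LessThan sum_distrib_right sum_distrib_left mult_ac)
  finally show "(outer_prod u v * outer_prod w x) $$ (i, j) = ((w \<bullet>c v) \<cdot>\<^sub>m outer_prod u x) $$ (i, j)"
    using assms ij by (simp add: outer_prod_def)
qed (use assms in \<open>auto simp: outer_prod_def\<close>)

lemma mat_trace_smult:
  "A \<in> carrier_mat n n \<Longrightarrow> mat_trace (c \<cdot>\<^sub>m A) = c * mat_trace A"
  unfolding mat_trace_def by (simp add: sum_distrib_left)

lemma mat_trace_outer_prod:
  assumes "v \<in> carrier_vec n" "w \<in> carrier_vec n"
  shows "mat_trace (outer_prod v w) = v \<bullet>c w"
  using assms by (auto simp: mat_trace_def outer_prod_def scalar_prod_def atLeast0LessThan intro!: sum.cong)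

lemma outer_prod_adjoint: "mat_adjoint (outer_prod v w) = outer_prod w v"
  by (intro eq_matI) (auto simp: outer_prod_def)

lemma outer_prod_mult_vec:
  assumes "u \<in> carrier_vec n" "v \<in> carrier_vec m" "w \<in> carrier_vec m"
  shows "outer_prod u v *\<^sub>v w = (w \<bullet>c v) \<cdot>\<^sub>v u"
  using assms
  by (intro eq_vecI) (auto simp: outer_prod_def scalar_prod_def sum_distrib_right sum_distrib_left mult_ac intro!: sum.cong)

lemma inner_commute:
  fixes v :: "complex vec"
  assumes "v \<in> carrier_vec n" "w \<in> carrier_vec n"
  shows "w \<bullet>c v = cnj (v \<bullet>c w)"
  using assms by (simp add: scalar_prod_def mult.commute)

lemma positive_semidefinite_ket_bra:
  assumes v: "v \<in> carrier_vec n"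
  shows "positive_semidefinite n (ket_bra v)"
  unfolding positive_semidefinite_def ket_bra_outer_prod
proof (intro conjI ballI)
  fix w :: "complex vec" assume w: "w \<in> carrier_vec n"
  have "(outer_prod v v *\<^sub>v w) \<bullet>c w = (w \<bullet>c v) * cnj (w \<bullet>c v)"
    using v w inner_commute[OF w v] by (simp add: outer_prod_mult_vec[of _ n _ n])
  thus "0 \<le> Re ((outer_prod v v *\<^sub>v w) \<bullet>c w)" by simp
qed (use v in \<open>auto simp: outer_prod_adjoint\<close>)

text \<open>With the basis vectors as columns of \<open>U\<close>, orthonormality says that the
  adjoint is a left inverse. It is then a right inverse too, which is completeness entry by entry.
  The operators are non-zero because each has trace one.\<close>

lemma is_measurement_ket_bra:
  assumes e: "orthonormal_basis n e"
  shows "is_measurement n n (\<lambda>a. ket_bra (e a))"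
proof -
  have ec: "e a \<in> carrier_vec n" if "a \<in> {1..n}" for a using e that unfolding orthonormal_basis_def by auto
  have ei: "e b \<bullet>c e a = (if a = b then 1 else 0)" if "a \<in> {1..n}" "b \<in> {1..n}" for a b
    using e that unfolding orthonormal_basis_def by auto
  \<comment> \<open>Outcomes are numbered from 1, columns from 0.\<close>
  define U where "U = mat n n (\<lambda>(i, a). e (Suc a) $ i)"
  have U: "U \<in> carrier_mat n n" unfolding U_def by auto
  have "mat_adjoint U * U = 1\<^sub>m n"
  proof (rule eq_matI)
    fix a b assume "a < dim_row (1\<^sub>m n :: complex mat)" "b < dim_col (1\<^sub>m n :: complex mat)"
    hence ab: "a < n" "b < n" by auto
    have "(mat_adjoint U * U) $$ (a, b) = (\<Sum>k<n. cnj (e (Suc a) $ k) * e (Suc b) $ k)"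
      using U ab by (subst index_mult_mat_sum[of _ n n _ n]) (auto simp: U_def)
    also have "\<dots> = e (Suc b) \<bullet>c e (Suc a)"
      using ec[of "Suc a"] ec[of "Suc b"] ab by (auto simp: scalar_prod_def atLeast0LessThan mult.commute intro!: sum.cong)
    finally show "(mat_adjoint U * U) $$ (a, b) = 1\<^sub>m n $$ (a, b)" using ei ab by auto
  qed (use U in auto)
  hence "unitary_mat n U" using U unfolding unitary_mat_def by auto
  note UU = unitary_matD(4)[OF this]
  have "(\<Sum>a=1..n. ket_bra (e a) $$ (i, j)) = 1\<^sub>m n $$ (i, j)" if ij: "i < n" "j < n" for i j
  proof -
    have "(\<Sum>a=1..n. ket_bra (e a) $$ (i, j)) = (\<Sum>a<n. e (Suc a) $ i * cnj (e (Suc a) $ j))"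
      using ij ec unfolding One_nat_def sum.atLeast1_atMost_eq by (intro sum.cong) (auto simp: ket_bra_def carrier_vecD[OF ec])
    also have "\<dots> = (U * mat_adjoint U) $$ (i, j)"
      using U ij by (subst index_mult_mat_sum[of _ n n _ n]) (auto simp: U_def)
    finally show ?thesis unfolding UU .
  qed
  hence "mat n n (\<lambda>(i, j). \<Sum>a=1..n. ket_bra (e a) $$ (i, j)) = 1\<^sub>m n"
    by (intro eq_matI) (auto simp del: One_nat_def)
  moreover have "ket_bra (e a) \<noteq> 0\<^sub>m n n" if "a \<in> {1..n}" for a
  proof
    assume "ket_bra (e a) = 0\<^sub>m n n"
    hence "mat_trace (ket_bra (e a)) = 0" by (simp add: mat_trace_def)
    thus False using mat_trace_outer_prod[OF ec ec, OF that that] ei[OF that that] unfolding ket_bra_outer_prod by simp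
  qed
  ultimately show ?thesis
    unfolding is_measurement_def using positive_semidefinite_ket_bra ec by auto
qed

text \<open>The relations for \<open>P * Q * P\<close> and \<open>Q * P * Q\<close> close the span
  of \<open>P\<close>, \<open>Q\<close>, \<open>P * Q\<close> and \<open>Q * P\<close> under
  multiplication, so powers of \<open>K\<close> reduce to these four words.\<close>

lemma commutator_projections_cube:
  fixes P Q :: "complex mat"
  assumes P: "P \<in> carrier_mat n n" and Q: "Q \<in> carrier_mat n n"
    and PP: "P * P = P" and QQ: "Q * Q = Q" and PQP: "P * Q * P = t \<cdot>\<^sub>m P" and QPQ: "Q * P * Q = t \<cdot>\<^sub>m Q"
  defines "K \<equiv> commutator P Q"
  shows "K * K = t \<cdot>\<^sub>m (P * Q + Q * P - (P + Q))"
    and "K * K * K = (t * (t - 1)) \<cdot>\<^sub>m K"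
proof -
  have Kd: "K = P * Q - Q * P" unfolding K_def commutator_def ..
  have K: "K \<in> carrier_mat n n" unfolding K_def by (rule commutator_carrier[OF P Q])
  have PQ: "P * Q \<in> carrier_mat n n" and QP: "Q * P \<in> carrier_mat n n" using P Q by auto
  note as = assoc_mult_mat[of _ n n _ n _ n]
  have QPP: "Q * P * P = Q * P" and PQQ: "P * Q * Q = P * Q" using P Q by (simp_all add: as PP QQ)
  have KP: "K * P = t \<cdot>\<^sub>m P - Q * P"
    unfolding Kd minus_mult_distrib_mat[OF PQ QP P] PQP QPP ..
  have KQ: "K * Q = P * Q - t \<cdot>\<^sub>m Q"
    unfolding Kd minus_mult_distrib_mat[OF PQ QP Q] QPQ PQQ ..
  have "K * (P * Q) = K * P * Q" using K P Q by (simp add: as)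
  also have "\<dots> = t \<cdot>\<^sub>m (P * Q) - t \<cdot>\<^sub>m Q"
    unfolding KP using P Q PQ QP by (simp add: minus_mult_distrib_mat[of _ n n _ _ n] QPQ mult_smult_assoc_mat[of _ n n _ n] del: assoc_mult_mat)
  finally have KPQ: "K * (P * Q) = t \<cdot>\<^sub>m (P * Q) - t \<cdot>\<^sub>m Q" .
  have "K * (Q * P) = K * Q * P" using K P Q by (simp add: as)
  also have "\<dots> = t \<cdot>\<^sub>m P - t \<cdot>\<^sub>m (Q * P)"
    unfolding KQ using P Q PQ QP by (simp add: minus_mult_distrib_mat[of _ n n _ _ n] PQP mult_smult_assoc_mat[of _ n n _ n] del: assoc_mult_mat)
  finally have KQP: "K * (Q * P) = t \<cdot>\<^sub>m P - t \<cdot>\<^sub>m (Q * P)" .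
  have "K * K = K * (P * Q) - K * (Q * P)"
    by (subst (2) Kd) (rule mult_minus_distrib_mat[OF K PQ QP])
  also have "\<dots> = t \<cdot>\<^sub>m (P * Q + Q * P - (P + Q))"
    unfolding KPQ KQP using P Q
    by (intro eq_matI) (auto simp: algebra_simps simp del: index_mult_mat(1))
  finally show KK: "K * K = t \<cdot>\<^sub>m (P * Q + Q * P - (P + Q))" .
  have "K * K * K = K * (K * K)" using K by (simp add: as)
  also have "\<dots> = t \<cdot>\<^sub>m (K * (P * Q + Q * P - (P + Q)))"
    unfolding KK using K P Q PQ QP by (intro mult_smult_distrib) auto
  also have "K * (P * Q + Q * P - (P + Q)) = K * (P * Q) + K * (Q * P) - (K * P + K * Q)"
    using K P Q PQ QP
    by (simp add: mult_minus_distrib_mat[of _ n n _ n] mult_add_distrib_mat[of _ n n _ n] del: assoc_mult_mat)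
  \<comment> \<open>The terms in \<open>P\<close> and \<open>Q\<close> alone cancel, leaving
    \<open>t - 1\<close> times the commutator inside.\<close>
  also have "t \<cdot>\<^sub>m \<dots> = (t * (t - 1)) \<cdot>\<^sub>m K"
    unfolding KPQ KQP KP KQ unfolding Kd using P Q
    by (intro eq_matI) (auto simp: algebra_simps simp del: index_mult_mat(1))
  finally show "K * K * K = (t * (t - 1)) \<cdot>\<^sub>m K" .
qed

text \<open>The cubic relation forces every \<open>\<bar>l i\<bar>\<close> to be \<open>0\<close> or
  \<open>s\<close>; for positive \<open>s\<close> the sum of squares then says that \<open>s\<close>
  occurs exactly twice.\<close>

lemma schatten_norm_two_equal:
  fixes n :: nat
  assumes sv: "singular_values K = image_mset (\<lambda>i. \<bar>l i\<bar>) (mset_set {..<n})"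
    and l3: "\<And>i. i < n \<Longrightarrow> l i ^ 3 = s\<^sup>2 * l i" and l2: "(\<Sum>i<n. (l i)\<^sup>2) = 2 * s\<^sup>2"
    and s: "0 \<le> s" and p: "1 \<le> p" and n: "1 \<le> n"
  shows "schatten_norm p K = two_powr_inverse p * s"
proof -
  have ls: "\<bar>l i\<bar> = 0 \<or> \<bar>l i\<bar> = s" if "i < n" for i
  proof -
    have "l i * ((l i)\<^sup>2 - s\<^sup>2) = 0" using l3[OF that] by (simp add: power3_eq_cube power2_eq_square algebra_simps)
    thus ?thesis using s by (auto simp: power2_eq_iff)
  qed
  show ?thesis
  proof (cases "p = \<infinity>")
    case True
    have "\<exists>i<n. \<bar>l i\<bar> = s"
    proof (rule ccontr)
      \<comment> \<open>If no entry had modulus \<open>s\<close>, all would vanish, the sum of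
        squares would force \<open>s = 0\<close>, and the entry at index 0 would have modulus
        \<open>s\<close> after all.\<close>
      assume neg: "\<not> (\<exists>i<n. \<bar>l i\<bar> = s)"
      hence "\<And>i. i < n \<Longrightarrow> l i = 0" using ls by force
      moreover from this have "s = 0" using l2 by simp
      ultimately show False using neg n by (auto dest: spec[of _ 0])
    qed
    then obtain i where i: "i < n" "\<bar>l i\<bar> = s" by auto
    have "Max ((\<lambda>i. \<bar>l i\<bar>) ` {..<n}) = s"
    proof (rule Max_eqI)
      show "s \<in> (\<lambda>i. \<bar>l i\<bar>) ` {..<n}" using i by auto
      show "\<And>y. y \<in> (\<lambda>i. \<bar>l i\<bar>) ` {..<n} \<Longrightarrow> y \<le> s" using ls s by fastforce
    qed simp
    thus ?thesis unfolding schatten_norm_def two_powr_inverse_def sv using True by simp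
  next
    case False
    define q where "q = real_of_ereal p"
    have q: "1 \<le> q" unfolding q_def using p False by (cases p) auto
    have "(\<Sum>i<n. \<bar>l i\<bar> powr q) = 2 * s powr q"
    proof (cases "s = 0")
      case True
      thus ?thesis using ls by simp
    next
      case False
      \<comment> \<open>The quotient is the indicator of a non-zero entry, so \<open>l2\<close> does
        the counting.\<close>
      have "\<bar>l i\<bar> powr q = (l i)\<^sup>2 / s\<^sup>2 * s powr q" if "i < n" for i
      proof (cases "l i = 0")
        case nz: False
        hence "\<bar>l i\<bar> = s" using ls[OF that] by simp
        moreover from this have "(l i)\<^sup>2 = s\<^sup>2" by (metis power2_abs)
        ultimately show ?thesis using False by simp
      qed simp
      hence "(\<Sum>i<n. \<bar>l i\<bar> powr q) = (\<Sum>i<n. (l i)\<^sup>2) / s\<^sup>2 * s powr q"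
        unfolding sum_divide_distrib sum_distrib_right by (intro sum.cong) auto
      thus ?thesis unfolding l2 using False by simp
    qed
    moreover have "(2 * s powr q) powr (1 / q) = 2 powr (1 / q) * s"
      using q s by (simp add: powr_mult powr_powr)
    ultimately show ?thesis unfolding schatten_norm_def two_powr_inverse_def sv using False
      by (simp add: image_mset.compositionality o_def sum_unfold_sum_mset flip: q_def)
  qed
qed

text \<open>The identities for the square and the cube of the commutator pass to its diagonal form,
  where the imaginary unit turns the factor \<open>t * (t - 1)\<close> into
  \<open>t * (1 - t)\<close>. This puts the \<open>l i\<close> into the situation of
  \<open>schatten_norm_two_equal\<close>.\<close>

lemma schatten_norm_commutator_ket_bra:
  assumes v: "v \<in> carrier_vec n" and w: "w \<in> carrier_vec n"
    and vv: "v \<bullet>c v = 1" and ww: "w \<bullet>c w = 1"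
    and p: "1 \<le> p" and n: "1 \<le> n"
  defines "t \<equiv> (cmod (w \<bullet>c v))\<^sup>2"
  assumes t: "t \<le> 1"
  shows "schatten_norm p (commutator (ket_bra v) (ket_bra w)) = two_powr_inverse p * sqrt (t * (1 - t))"
proof -
  let ?P = "outer_prod v v" and ?Q = "outer_prod w w"
  let ?K = "commutator ?P ?Q"
  have P: "?P \<in> carrier_mat n n" and Q: "?Q \<in> carrier_mat n n" using v w by auto
  have K: "?K \<in> carrier_mat n n" by (rule commutator_carrier[OF P Q])
  have tc: "complex_of_real t = w \<bullet>c v * (v \<bullet>c w)"
    unfolding t_def inner_commute[OF w v] complex_norm_square by simp
  have one: "1 \<cdot>\<^sub>m A = A" for A :: "complex mat" by (intro eq_matI) auto
  have PP: "?P * ?P = ?P" and QQ: "?Q * ?Q = ?Q"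
    using v w vv ww one by (simp_all add: outer_prod_mult[of _ n _ n _ _ n])
  have PQ: "?P * ?Q = (w \<bullet>c v) \<cdot>\<^sub>m outer_prod v w" and QP: "?Q * ?P = (v \<bullet>c w) \<cdot>\<^sub>m outer_prod w v"
    using v w by (simp_all add: outer_prod_mult[of _ n _ n _ _ n])
  have ss: "a \<cdot>\<^sub>m (b \<cdot>\<^sub>m A) = (a * b) \<cdot>\<^sub>m A" for a b and A :: "complex mat" by (intro eq_matI) auto
  have PQP: "?P * ?Q * ?P = complex_of_real t \<cdot>\<^sub>m ?P" and QPQ: "?Q * ?P * ?Q = complex_of_real t \<cdot>\<^sub>m ?Q"
    unfolding PQ QP using v w
    by (simp_all add: mult_smult_assoc_mat[of _ n n _ n] outer_prod_mult[of _ n _ n _ _ n] tc mult_ac ss)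
  note K23 = commutator_projections_cube[OF P Q PP QQ PQP QPQ]
  have "mat_trace (?K * ?K) = complex_of_real t * (mat_trace (?P * ?Q) + mat_trace (?Q * ?P) - (mat_trace ?P + mat_trace ?Q))"
    unfolding K23(1) using carrier_matD[OF P] carrier_matD[OF Q]
    by (simp add: mat_trace_def sum_distrib_left sum_subtractf sum.distrib algebra_simps del: index_mult_mat(1))
  also have "mat_trace (?P * ?Q) = complex_of_real t"
    unfolding PQ tc mat_trace_outer_prod[OF v w, symmetric]
    by (rule mat_trace_smult[of _ n]) (use v w in simp)
  also have "mat_trace (?Q * ?P) = complex_of_real t"
    unfolding QP tc mult.commute[of "w \<bullet>c v"] mat_trace_outer_prod[OF w v, symmetric]
    using v w by (simp add: mat_trace_smult[of _ n] mult.commute)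
  also have "mat_trace ?P = 1" by (simp add: mat_trace_outer_prod[OF v v] vv)
  also have "mat_trace ?Q = 1" by (simp add: mat_trace_outer_prod[OF w w] ww)
  finally have trK: "mat_trace (?K * ?K) = complex_of_real (- 2 * (t * (1 - t)))"
    by (simp add: algebra_simps)
  obtain U l where U: "unitary_mat n U"
    and L: "mat_adjoint U * ?K * U = mat_diag n (\<lambda>i. \<i> * complex_of_real (l i))"
    and sv: "singular_values ?K = image_mset (\<lambda>i. \<bar>l i\<bar>) (mset_set {..<n})"
    using anti_hermitian_diagonalization[OF K mat_adjoint_commutator[OF P Q outer_prod_adjoint outer_prod_adjoint]] .
  note UD = unitary_matD[OF U]
  note sq = assoc_mult_mat[of _ n n _ n _ n] mult_carrier_mat[of _ n n _ n]
  have cancel: "U * (mat_adjoint U * M) = M" if "M \<in> carrier_mat n n" for M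
    using UD that by (subst assoc_mult_mat[of _ n n _ n _ n, symmetric]) auto
  let ?L = "mat_diag n (\<lambda>i. \<i> * complex_of_real (l i))"
  have LL: "mat_adjoint U * (?K * ?K) * U = ?L * ?L"
    unfolding L[symmetric] using UD K by (simp add: sq cancel)
  have LLL: "mat_adjoint U * (?K * ?K * ?K) * U = ?L * ?L * ?L"
    unfolding L[symmetric] using UD K by (simp add: sq cancel)
  have "mat_trace (?L * ?L) = mat_trace (?K * ?K)"
    unfolding LL[symmetric] using K by (intro mat_trace_unitary[OF U]) auto
  moreover have "mat_trace (?L * ?L) = complex_of_real (- (\<Sum>i<n. (l i)\<^sup>2))"
    unfolding mat_diag_diag by (simp add: mat_trace_def mat_diag_def power2_eq_square sum_negf mult_ac)
  ultimately have "complex_of_real (- (\<Sum>i<n. (l i)\<^sup>2)) = complex_of_real (- 2 * (t * (1 - t)))"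
    using trK by simp
  hence l2: "(\<Sum>i<n. (l i)\<^sup>2) = 2 * (sqrt (t * (1 - t)))\<^sup>2"
    unfolding of_real_eq_iff using t by (simp add: t_def)
  have "mat_adjoint U * (?K * ?K * ?K) * U = (complex_of_real t * (complex_of_real t - 1)) \<cdot>\<^sub>m ?L"
    unfolding K23(2) L[symmetric] using UD K
    by (simp add: mult_smult_distrib[of _ n n _ n] mult_smult_assoc_mat[of _ n n _ n] sq)
  with LLL have L3: "?L * ?L * ?L = (complex_of_real t * (complex_of_real t - 1)) \<cdot>\<^sub>m ?L" by simp
  have l3: "l i ^ 3 = (sqrt (t * (1 - t)))\<^sup>2 * l i" if i: "i < n" for i
  proof -
    have "\<i> * complex_of_real (l i) * (\<i> * complex_of_real (l i)) * (\<i> * complex_of_real (l i))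
       = complex_of_real t * (complex_of_real t - 1) * (\<i> * complex_of_real (l i))"
      using arg_cong[OF L3, of "\<lambda>M. M $$ (i, i)"] i unfolding mat_diag_diag by (simp add: mat_diag_def)
    from arg_cong[OF this, of Im] have "l i ^ 3 = t * (1 - t) * l i"
      by (simp add: power3_eq_cube algebra_simps)
    thus ?thesis using t by (simp add: t_def)
  qed
  show ?thesis unfolding ket_bra_outer_prod
    by (rule schatten_norm_two_equal[OF sv l3 l2 _ p n]) (use t in \<open>auto simp: t_def\<close>)
qed

text \<open>All \<open>n\<^sup>2\<close> terms agree: each has \<open>t = 1 / n\<close>, and
  \<open>sqrt (t * (1 - t))\<close> is then \<open>sqrt (n - 1) / n\<close>.\<close>

lemma Upsilon_mutually_unbiased_bases:
  assumes ef: "mutually_unbiased_bases n e f" and p: "1 \<le> p" and n: "1 \<le> n"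
  shows "Upsilon p n n (\<lambda>a. ket_bra (e a)) (\<lambda>b. ket_bra (f b)) = two_powr_inverse p * real n * sqrt (real n - 1)"
proof -
  have "schatten_norm p (commutator (ket_bra (e a)) (ket_bra (f b)))
      = two_powr_inverse p * sqrt (1 / real n * (1 - 1 / real n))" if ab: "a \<in> {1..n}" "b \<in> {1..n}" for a b
  proof -
    have "(cmod (f b \<bullet>c e a))\<^sup>2 = 1 / real n"
      using ef ab unfolding mutually_unbiased_bases_def by blast
    moreover have "e a \<in> carrier_vec n" "f b \<in> carrier_vec n" "e a \<bullet>c e a = 1" "f b \<bullet>c f b = 1"
      using ef ab unfolding mutually_unbiased_bases_def orthonormal_basis_def by auto
    ultimately show ?thesis
      using schatten_norm_commutator_ket_bra[of "e a" n "f b" p] p n by simp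
  qed
  hence "Upsilon p n n (\<lambda>a. ket_bra (e a)) (\<lambda>b. ket_bra (f b))
      = real n * real n * (two_powr_inverse p * sqrt (1 / real n * (1 - 1 / real n)))"
    unfolding Upsilon_def by simp
  also have "1 / real n * (1 - 1 / real n) = (real n - 1) / (real n)\<^sup>2"
    using n by (simp add: field_simps power2_eq_square)
  also have "real n * real n * (two_powr_inverse p * sqrt ((real n - 1) / (real n)\<^sup>2))
      = two_powr_inverse p * real n * sqrt (real n - 1)"
    using n by (simp add: real_sqrt_divide)
  finally show ?thesis .
qed

text \<open>Orthogonality of the Fourier vectors is the vanishing of a geometric sum over a
  non-trivial root of unity. Unbiasedness holds because each of their coordinates has modulus
  \<open>1 / sqrt n\<close>.\<close>

lemma mutually_unbiased_bases_exist:
  assumes n: "1 \<le> n"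
  obtains e f where "mutually_unbiased_bases n e f"
proof -
  define \<omega> where "\<omega> k = cis (2 * pi * real k / real n)" for k
  \<comment> \<open>Basis labels start at 1, coordinates and exponents at 0, hence the
    shifts.\<close>
  define e where "e j = (unit_vec n (j - 1) :: complex vec)" for j :: nat
  define f where "f k = vec n (\<lambda>i. \<omega> (k - 1) ^ i / complex_of_real (sqrt (real n)))" for k
  have nn: "complex_of_real (sqrt (real n)) * complex_of_real (sqrt (real n)) = of_nat n"
    by (simp flip: of_real_mult)
  have bij: "bij_betw \<omega> {..<n} {z. z ^ n = 1}"
    unfolding \<omega>_def using n by (intro bij_betw_roots_unity) auto
  have cm: "cmod (\<omega> k) = 1" for k unfolding \<omega>_def by simp
  have cc: "\<omega> k * cnj (\<omega> k) = 1" for k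
    using complex_norm_square[of "\<omega> k"] cm[of k] by simp
  have root: "\<omega> k ^ n = 1" if "k < n" for k using bij that by (auto simp: bij_betw_def)
  have ff: "f k \<bullet>c f j = (if j = k then 1 else 0)" if jk: "j \<in> {1..n}" "k \<in> {1..n}" for j k
  proof -
    \<comment> \<open>Conjugation inverts on the unit circle, so \<open>z\<close> is the quotient of
      two roots of unity.\<close>
    define z where "z = \<omega> (k - 1) * cnj (\<omega> (j - 1))"
    have "f k \<bullet>c f j = (\<Sum>i<n. z ^ i / of_nat n)"
      unfolding f_def z_def by (auto simp: scalar_prod_def atLeast0LessThan nn power_mult_distrib intro!: sum.cong)
    hence fz: "f k \<bullet>c f j = (\<Sum>i<n. z ^ i) / of_nat n" by (simp add: sum_divide_distrib)
    show ?thesis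
    proof (cases "j = k")
      case True
      hence "z = 1" unfolding z_def using cc by simp
      thus ?thesis using fz True n by simp
    next
      case False
      have "z \<noteq> 1"
      proof
        assume "z = 1"
        hence "\<omega> (k - 1) = \<omega> (k - 1) * cnj (\<omega> (j - 1)) * \<omega> (j - 1)"
          using cc[of "j - 1"] by (simp add: mult.assoc mult.commute)
        also have "\<dots> = \<omega> (j - 1)" using \<open>z = 1\<close> unfolding z_def by simp
        finally have "k - 1 = j - 1"
          using bij jk unfolding bij_betw_def by (elim conjE inj_onD) auto
        \<comment> \<open>Both labels are at least 1, so the truncated subtraction loses
          nothing.\<close>
        thus False using False jk by auto
      qed
      moreover have "k - 1 < n" "j - 1 < n" using jk by auto
      hence "z ^ n = 1" unfolding z_def power_mult_distrib complex_cnj_power[symmetric]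
        by (simp only: root) simp
      ultimately have "(\<Sum>i<n. z ^ i) = 0" by (simp add: geometric_sum)
      thus ?thesis using fz False by simp
    qed
  qed
  have ee: "e k \<bullet>c e j = (if j = k then 1 else 0)" if "j \<in> {1..n}" "k \<in> {1..n}" for j k
  proof -
    have "conjugate (e j) = e j" unfolding e_def by (intro eq_vecI) (auto simp: unit_vec_def)
    hence "e k \<bullet>c e j = e j $ (k - 1)"
      using that unfolding e_def by (subst scalar_prod_left_unit[of _ n]) auto
    thus ?thesis using that unfolding e_def by auto
  qed
  have "(cmod (f k \<bullet>c e j))\<^sup>2 = 1 / real n" if jk: "j \<in> {1..n}" "k \<in> {1..n}" for j k
  proof -
    have "conjugate (e j) = e j" unfolding e_def by (intro eq_vecI) (auto simp: unit_vec_def)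
    hence "f k \<bullet>c e j = f k $ (j - 1)"
      using jk unfolding e_def by (subst scalar_prod_right_unit[of _ n, symmetric]) (auto simp: f_def)
    thus ?thesis using jk by (auto simp: f_def norm_divide norm_power cm power_divide)
  qed
  hence "mutually_unbiased_bases n e f"
    unfolding mutually_unbiased_bases_def orthonormal_basis_def using ee ff by (auto simp: e_def f_def)
  thus ?thesis by (rule that)
qed

theorem lemma5:
  fixes p :: ereal and d :: nat
  assumes "1 \<le> p" and "1 \<le> d"
  shows
    "(\<forall>nE nF E F. is_measurement d nE E \<and> is_measurement d nF F \<longrightarrow>
        Upsilon p nE nF E F \<le> two_powr_inverse p * real d * sqrt (real d - 1)) \<and>
     (\<forall>e f. mutually_unbiased_bases d e f \<longrightarrow>
        is_measurement d d (\<lambda>a. ket_bra (e a)) \<and>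
        is_measurement d d (\<lambda>b. ket_bra (f b)) \<and>
        Upsilon p d d (\<lambda>a. ket_bra (e a)) (\<lambda>b. ket_bra (f b)) =
          two_powr_inverse p * real d * sqrt (real d - 1)) \<and>
     (\<exists>nE nF E F. is_measurement d nE E \<and> is_measurement d nF F \<and>
        Upsilon p nE nF E F = two_powr_inverse p * real d * sqrt (real d - 1))"
proof -
  have bound: "\<forall>nE nF E F. is_measurement d nE E \<and> is_measurement d nF F \<longrightarrow>
        Upsilon p nE nF E F \<le> two_powr_inverse p * real d * sqrt (real d - 1)"
    using Upsilon_le assms by blast
  have tight: "is_measurement d d (\<lambda>a. ket_bra (e a)) \<and> is_measurement d d (\<lambda>b. ket_bra (f b)) \<and>
        Upsilon p d d (\<lambda>a. ket_bra (e a)) (\<lambda>b. ket_bra (f b)) =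
          two_powr_inverse p * real d * sqrt (real d - 1)" if "mutually_unbiased_bases d e f" for e f
    using that is_measurement_ket_bra Upsilon_mutually_unbiased_bases[OF that assms]
    unfolding mutually_unbiased_bases_def by blast
  \<comment> \<open>The last conjunct asserts attainment unconditionally, so an actual unbiased pair
    in dimension \<open>d\<close> has to be supplied.\<close>
  obtain e f where "mutually_unbiased_bases d e f"
    using mutually_unbiased_bases_exist[OF assms(2)] .
  with bound tight show ?thesis by blast
qed

end
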